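(* The locally closed subsets $\gamma(H)$ of $\operatorname{Spec} R$, indexed by the subgroups $H$ of $G$, form a stratification of $\operatorname{Spec} R$, in the sense that $$\operatorname{Spec} R=\bigsqcup_{H\subseteq G}\gamma(H),$$ where the (disjoint) union is over all subgroups $H$ of $G$.
   Context: Setup: $G$ is a finite group, $D$ is a nonempty set of nontrivial conjugacy classes of $G$, $\xi:D\to\mathbb{Z}_{>0}$ is a map, $|\xi|=\sum_{\gamma\in D}\xi(\gamma)$, and $k$ is a field whose characteristic does not divide $|G|$. The Artin braid group $\mathrm{B}_n$ (standard generators $\sigma_1,\dots,\sigma_{n-1}$) acts on $G^n$ by the Hurwitz action: $\sigma_i$ replaces the entries $(g_i,g_{i+1})$ in positions $i,i+1$ by $(g_ig_{i+1}g_i^{-1},g_i)$ and fixes the other entries. The product $g_1\cdots g_n$ and the subgroup $\langle g_1,\dots,g_n\rangle$ of $G$ are invariant under this action. A component of degree $n$ is an orbit, under $\mathrm{B}_{n|\xi|}$, of a tuple $(g_1,\dots,g_{n|\xi|})\in G^{n|\xi|}$ with $g_1\cdots g_{n|\xi|}=1$ and such that exactly $n\,\xi(\gamma)$ entries belong to $\gamma$, for each $\gamma\in D$. The group $\langle m\rangle$ of a component $m$ is the subgroup of $G$ generated by the entries of a representing tuple. Components of all degrees $n\ge 0$ form, under concatenation, a commutative finitely generated graded monoid $\mathrm{Comp}$, with identity the orbit of the empty tuple. The ring of components is the monoid ring $R=k[\mathrm{Comp}]$, a finitely generated commutative graded $k$-algebra. For a subgroup $H\subseteq G$: $I_H$ (resp.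 $I_H^*$) is the homogeneous ideal of $R$ spanned over $k$ by the components whose group contains $H$ (resp. properly contains $H$). For an ideal $I$ of $R$, $V(I)$ is the closed set of prime ideals containing $I$. The stratum associated to $H$ is $\gamma(H)=V(I_H^* )\setminus V(I_H)$. *)

theory Defs
  imports "HOL-Analysis.Abstract_Topology" "HOL-Algebra.Algebra"
begin

definition conjugacy_classes :: "('g, 'x) monoid_scheme \<Rightarrow> 'g set set" where
  "conjugacy_classes G =
     orbits G (carrier G) (\<lambda>g. \<lambda>h \<in> carrier G. g \<otimes>\<^bsub>G\<^esub> h \<otimes>\<^bsub>G\<^esub> inv\<^bsub>G\<^esub> g)"

text \<open>In characteristic zero the value is 0, and \<open>0 dvd n\<close> holds only for \<open>n = 0\<close>.\<close>

definition ring_characteristic :: "('k, 'y) ring_scheme \<Rightarrow> nat" where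
  "ring_characteristic K =
     (if \<exists>n>0. add_pow K (n::nat) \<one>\<^bsub>K\<^esub> = \<zero>\<^bsub>K\<^esub>
      then LEAST n. n > 0 \<and> add_pow K n \<one>\<^bsub>K\<^esub> = \<zero>\<^bsub>K\<^esub> else 0)"


section \<open>The Artin braid group and the Hurwitz action\<close>

text \<open>The letter \<open>(i, True)\<close> stands for the generator \<open>\<sigma>\<^sub>i\<close>, and \<open>(i, False)\<close> for its inverse.\<close>

type_synonym braid_word = "(nat \<times> bool) list"

definition braid_words :: "nat \<Rightarrow> braid_word set" where
  "braid_words n = lists ({1..<n} \<times> UNIV)"

text \<open>The congruence on words defining the Artin presentation; for \<open>n \<le> 1\<close> the group is trivial.\<close>

inductive braid_eq :: "nat \<Rightarrow> braid_word \<Rightarrow> braid_word \<Rightarrow> bool" for n where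
  refl: "w \<in> braid_words n \<Longrightarrow> braid_eq n w w"
| sym: "braid_eq n u v \<Longrightarrow> braid_eq n v u"
| trans: "braid_eq n u v \<Longrightarrow> braid_eq n v w \<Longrightarrow> braid_eq n u w"
| append: "braid_eq n u u' \<Longrightarrow> braid_eq n v v' \<Longrightarrow> braid_eq n (u @ v) (u' @ v')"
| cancel: "i \<in> {1..<n} \<Longrightarrow> braid_eq n [(i, e), (i, \<not> e)] []"
| far: "i \<in> {1..<n} \<Longrightarrow> j \<in> {1..<n} \<Longrightarrow> i + 2 \<le> j \<Longrightarrow>
    braid_eq n [(i, True), (j, True)] [(j, True), (i, True)]"
| braid: "i \<in> {1..<n} \<Longrightarrow> i + 1 \<in> {1..<n} \<Longrightarrow>
    braid_eq n [(i, True), (i + 1, True), (i, True)] [(i + 1, True), (i, True), (i + 1, True)]"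

definition braid_rel :: "nat \<Rightarrow> (braid_word \<times> braid_word) set" where
  "braid_rel n = {(u, v). braid_eq n u v}"

definition braid_group :: "nat \<Rightarrow> braid_word set monoid" where
  "braid_group n =
     \<lparr>carrier = braid_words n // braid_rel n,
      monoid.mult = (\<lambda>a b. \<Union>u\<in>a. \<Union>v\<in>b. braid_rel n `` {u @ v}),
      one = braid_rel n `` {[]}\<rparr>"

text \<open>Positions are numbered from 1 as in \<open>\<sigma>\<^sub>i\<close>, list indices from 0.\<close>

fun hurwitz_letter :: "('g, 'x) monoid_scheme \<Rightarrow> nat \<times> bool \<Rightarrow> 'g list \<Rightarrow> 'g list" where
  "hurwitz_letter G (i, True) xs =
     (let a = xs ! (i - 1); b = xs ! i in xs[i - 1 := a \<otimes>\<^bsub>G\<^esub> b \<otimes>\<^bsub>G\<^esub> inv\<^bsub>G\<^esub> a, i := a])"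
| "hurwitz_letter G (i, False) xs =
     (let a = xs ! (i - 1); b = xs ! i in xs[i - 1 := b, i := inv\<^bsub>G\<^esub> b \<otimes>\<^bsub>G\<^esub> a \<otimes>\<^bsub>G\<^esub> b])"

text \<open>A word acts from the left: its last letter is applied first.\<close>

definition hurwitz_word :: "('g, 'x) monoid_scheme \<Rightarrow> braid_word \<Rightarrow> 'g list \<Rightarrow> 'g list" where
  "hurwitz_word G w xs = foldr (hurwitz_letter G) w xs"

definition tuples :: "('g, 'x) monoid_scheme \<Rightarrow> nat \<Rightarrow> 'g list set" where
  "tuples G n = {xs. set xs \<subseteq> carrier G \<and> length xs = n}"

text \<open>The choice of the representing word does not matter (\<open>hurwitz_action_class\<close> below).\<close>

definition hurwitz_action ::
    "('g, 'x) monoid_scheme \<Rightarrow> nat \<Rightarrow> braid_word set \<Rightarrow> 'g list \<Rightarrow> 'g list" where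
  "hurwitz_action G n b = (\<lambda>xs \<in> tuples G n. hurwitz_word G (SOME w. w \<in> b) xs)"

definition hurwitz_orbit :: "('g, 'x) monoid_scheme \<Rightarrow> 'g list \<Rightarrow> 'g list set" where
  "hurwitz_orbit G xs = orbit (braid_group (length xs)) (hurwitz_action G (length xs)) xs"


section \<open>The monoid of components\<close>

definition component_tuples ::
    "('g, 'x) monoid_scheme \<Rightarrow> 'g set set \<Rightarrow> ('g set \<Rightarrow> nat) \<Rightarrow> nat \<Rightarrow> 'g list set" where
  "component_tuples G D \<xi> n =
     {xs \<in> tuples G (n * (\<Sum>\<gamma>\<in>D. \<xi> \<gamma>)).
        foldr (\<otimes>\<^bsub>G\<^esub>) xs \<one>\<^bsub>G\<^esub> = \<one>\<^bsub>G\<^esub> \<and>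
        (\<forall>\<gamma>\<in>D. length (filter (\<lambda>g. g \<in> \<gamma>) xs) = n * \<xi> \<gamma>)}"

definition components_of_degree ::
    "('g, 'x) monoid_scheme \<Rightarrow> 'g set set \<Rightarrow> ('g set \<Rightarrow> nat) \<Rightarrow> nat \<Rightarrow> 'g list set set" where
  "components_of_degree G D \<xi> n = hurwitz_orbit G ` component_tuples G D \<xi> n"

text \<open>
  All the orbits in the union defining the product coincide (\<open>Comp_mult\<close> below). Likewise the group of
  a component does not depend on the chosen tuple (\<open>component_group_eq\<close>).
\<close>

definition Comp ::
    "('g, 'x) monoid_scheme \<Rightarrow> 'g set set \<Rightarrow> ('g set \<Rightarrow> nat) \<Rightarrow> 'g list set monoid" where
  "Comp G D \<xi> =
     \<lparr>carrier = (\<Union>n. components_of_degree G D \<xi> n),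
      monoid.mult = (\<lambda>m m'. \<Union>x\<in>m. \<Union>y\<in>m'. hurwitz_orbit G (x @ y)),
      one = hurwitz_orbit G []\<rparr>"

definition component_group :: "('g, 'x) monoid_scheme \<Rightarrow> 'g list set \<Rightarrow> 'g set" where
  "component_group G m = generate G (set (SOME xs. xs \<in> m))"


section \<open>Monoid rings\<close>

text \<open>Finitely supported functions on \<open>carrier M\<close>, extended by zero, with convolution.\<close>

definition monoid_ring ::
    "('k, 'y) ring_scheme \<Rightarrow> ('m, 'z) monoid_scheme \<Rightarrow> ('k, 'm \<Rightarrow> 'k) module" where
  "monoid_ring K M =
     \<lparr>carrier = {f. (\<forall>m \<in> carrier M. f m \<in> carrier K) \<and> (\<forall>m. m \<notin> carrier M \<longrightarrow> f m = \<zero>\<^bsub>K\<^esub>) \<and>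
                    finite {m. f m \<noteq> \<zero>\<^bsub>K\<^esub>}},
      monoid.mult = (\<lambda>f g m.
        \<Oplus>\<^bsub>K\<^esub>p \<in> {(a, b). f a \<noteq> \<zero>\<^bsub>K\<^esub> \<and> g b \<noteq> \<zero>\<^bsub>K\<^esub> \<and> a \<otimes>\<^bsub>M\<^esub> b = m}. f (fst p) \<otimes>\<^bsub>K\<^esub> g (snd p)),
      one = (\<lambda>m. if m = \<one>\<^bsub>M\<^esub> then \<one>\<^bsub>K\<^esub> else \<zero>\<^bsub>K\<^esub>),
      ring.zero = (\<lambda>m. \<zero>\<^bsub>K\<^esub>),
      ring.add = (\<lambda>f g m. f m \<oplus>\<^bsub>K\<^esub> g m),
      module.smult = (\<lambda>c f m. c \<otimes>\<^bsub>K\<^esub> f m)\<rparr>"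

definition basis_element :: "('k, 'y) ring_scheme \<Rightarrow> 'm \<Rightarrow> 'm \<Rightarrow> 'k" where
  "basis_element K m = (\<lambda>x. if x = m then \<one>\<^bsub>K\<^esub> else \<zero>\<^bsub>K\<^esub>)"

definition linear_span ::
    "('k, 'y) ring_scheme \<Rightarrow> ('k, 'v, 'z) module_scheme \<Rightarrow> 'v set \<Rightarrow> 'v set" where
  "linear_span K V S =
     {\<Oplus>\<^bsub>V\<^esub>v \<in> A. c v \<odot>\<^bsub>V\<^esub> v | A c. finite A \<and> A \<subseteq> S \<and> c \<in> A \<rightarrow> carrier K}"


section \<open>The prime spectrum\<close>

definition Spec :: "('r, 'y) ring_scheme \<Rightarrow> 'r set set" where
  "Spec R = {P. primeideal P R}"

definition vanishing :: "('r, 'y) ring_scheme \<Rightarrow> 'r set \<Rightarrow> 'r set set" where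
  "vanishing R I = {P \<in> Spec R. I \<subseteq> P}"

text \<open>See \<open>istopology_zariski\<close> below for the topology axioms.\<close>

definition zariski :: "('r, 'y) ring_scheme \<Rightarrow> 'r set topology" where
  "zariski R = topology (\<lambda>U. \<exists>I. ideal I R \<and> U = Spec R - vanishing R I)"

definition locally_closedin :: "'a topology \<Rightarrow> 'a set \<Rightarrow> bool" where
  "locally_closedin T S = (\<exists>V Z. openin T V \<and> closedin T Z \<and> S = V \<inter> Z)"


section \<open>The ring of components and its stratification\<close>

definition ring_of_components ::
    "('g, 'x) monoid_scheme \<Rightarrow> 'g set set \<Rightarrow> ('g set \<Rightarrow> nat) \<Rightarrow> ('k, 'y) ring_scheme \<Rightarrow>
     ('k, 'g list set \<Rightarrow> 'k) module" where
  "ring_of_components G D \<xi> K = monoid_ring K (Comp G D \<xi>)"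

definition ideal_above ::
    "('g, 'x) monoid_scheme \<Rightarrow> 'g set set \<Rightarrow> ('g set \<Rightarrow> nat) \<Rightarrow> ('k, 'y) ring_scheme \<Rightarrow>
     'g set \<Rightarrow> ('g list set \<Rightarrow> 'k) set" where
  "ideal_above G D \<xi> K H = linear_span K (ring_of_components G D \<xi> K)
     (basis_element K ` {m \<in> carrier (Comp G D \<xi>). H \<subseteq> component_group G m})"

definition ideal_strictly_above ::
    "('g, 'x) monoid_scheme \<Rightarrow> 'g set set \<Rightarrow> ('g set \<Rightarrow> nat) \<Rightarrow> ('k, 'y) ring_scheme \<Rightarrow>
     'g set \<Rightarrow> ('g list set \<Rightarrow> 'k) set" where
  "ideal_strictly_above G D \<xi> K H = linear_span K (ring_of_components G D \<xi> K)
     (basis_element K ` {m \<in> carrier (Comp G D \<xi>). H \<subset> component_group G m})"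

definition stratum ::
    "('g, 'x) monoid_scheme \<Rightarrow> 'g set set \<Rightarrow> ('g set \<Rightarrow> nat) \<Rightarrow> ('k, 'y) ring_scheme \<Rightarrow>
     'g set \<Rightarrow> ('g list set \<Rightarrow> 'k) set set" where
  "stratum G D \<xi> K H =
     vanishing (ring_of_components G D \<xi> K) (ideal_strictly_above G D \<xi> K H) -
     vanishing (ring_of_components G D \<xi> K) (ideal_above G D \<xi> K H)"


section \<open>The braid group is a group acting on tuples\<close>

declare hurwitz_letter.simps [simp del]


lemma braid_words_Nil [simp]: "[] \<in> braid_words n"
  by (simp add: braid_words_def)

lemma braid_words_append [simp]: "u @ v \<in> braid_words n \<longleftrightarrow> u \<in> braid_words n \<and> v \<in> braid_words n"
  by (auto simp: braid_words_def)

lemma braid_words_Cons [simp]: "(i, e) # v \<in> braid_words n \<longleftrightarrow> i \<in> {1..<n} \<and> v \<in> braid_words n"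
  by (auto simp: braid_words_def)

lemma braid_eq_words: "braid_eq n u v \<Longrightarrow> u \<in> braid_words n \<and> v \<in> braid_words n"
  by (induction rule: braid_eq.induct) auto

lemma equiv_braid_rel: "equiv (braid_words n) (braid_rel n)"
proof (rule equivI)
  show "braid_rel n \<subseteq> braid_words n \<times> braid_words n"
    using braid_eq_words by (auto simp: braid_rel_def)
  show "refl_on (braid_words n) (braid_rel n)"
    by (simp add: refl_on_def braid_rel_def braid_eq.refl)
  show "sym (braid_rel n)"
    by (auto simp: sym_def braid_rel_def intro: braid_eq.sym)
  show "trans (braid_rel n)"
    unfolding trans_def braid_rel_def using braid_eq.trans by blast
qed

lemma braid_eq_class: "braid_eq n u v \<Longrightarrow> braid_rel n `` {u} = braid_rel n `` {v}"
  using equiv_class_eq[OF equiv_braid_rel] by (simp add: braid_rel_def)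

lemma braid_class_in: "w \<in> braid_words n \<Longrightarrow> braid_rel n `` {w} \<in> carrier (braid_group n)"
  by (simp add: braid_group_def quotientI)

lemma braid_class_cases:
  assumes "b \<in> carrier (braid_group n)"
  obtains w where "w \<in> braid_words n" "b = braid_rel n `` {w}"
  using assms by (auto simp: braid_group_def elim: quotientE)

lemma braid_mult:
  assumes "u \<in> braid_words n" "v \<in> braid_words n"
  shows "(braid_rel n `` {u}) \<otimes>\<^bsub>braid_group n\<^esub> (braid_rel n `` {v}) = braid_rel n `` {u @ v}"
proof -
  have eq: "braid_rel n `` {u' @ v'} = braid_rel n `` {u @ v}"
    if "u' \<in> braid_rel n `` {u}" "v' \<in> braid_rel n `` {v}" for u' v'
    using that braid_eq_class[OF braid_eq.append, of n u u' v v'] by (simp add: braid_rel_def)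
  have mem: "u \<in> braid_rel n `` {u}" "v \<in> braid_rel n `` {v}"
    using assms by (auto simp: braid_rel_def intro: braid_eq.refl)
  have "(\<Union>u'\<in>braid_rel n `` {u}. \<Union>v'\<in>braid_rel n `` {v}. braid_rel n `` {u' @ v'}) =
      (\<Union>u'\<in>braid_rel n `` {u}. \<Union>v'\<in>braid_rel n `` {v}. braid_rel n `` {u @ v})"
    by (intro SUP_cong HOL.refl eq)
  also have "\<dots> = braid_rel n `` {u @ v}" using mem by auto
  finally show ?thesis by (simp add: braid_group_def)
qed

definition braid_inverse :: "braid_word \<Rightarrow> braid_word" where
  "braid_inverse w = rev (map (\<lambda>(i, e). (i, \<not> e)) w)"

lemma braid_inverse_words [simp]: "braid_inverse w \<in> braid_words n \<longleftrightarrow> w \<in> braid_words n"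
  by (induction w) (auto simp: braid_inverse_def)

lemma braid_inverse_cancel:
  "w \<in> braid_words n \<Longrightarrow> braid_eq n (braid_inverse w @ w) []"
proof (induction w)
  case Nil
  then show ?case by (simp add: braid_inverse_def braid_eq.refl)
next
  case (Cons p w)
  obtain i e where p: "p = (i, e)" by (cases p)
  have w: "w \<in> braid_words n" "i \<in> {1..<n}" using Cons.prems p by auto
  have "braid_eq n ([(i, \<not> e), (i, \<not> \<not> e)] @ w) ([] @ w)"
    by (intro braid_eq.append braid_eq.cancel braid_eq.refl w)
  then have "braid_eq n (braid_inverse w @ ([(i, \<not> e), (i, e)] @ w)) (braid_inverse w @ w)"
    using w by (intro braid_eq.append braid_eq.refl) auto
  then have "braid_eq n (braid_inverse (p # w) @ (p # w)) (braid_inverse w @ w)"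
    by (simp add: p braid_inverse_def)
  then show ?case using Cons.IH w braid_eq.trans by blast
qed

lemma group_braid_group: "group (braid_group n)"
proof (rule groupI)
  have one: "\<one>\<^bsub>braid_group n\<^esub> = braid_rel n `` {[]}" by (simp add: braid_group_def)
  show "\<one>\<^bsub>braid_group n\<^esub> \<in> carrier (braid_group n)"
    unfolding one by (simp add: braid_class_in)
  fix a assume "a \<in> carrier (braid_group n)"
  then obtain u where u: "u \<in> braid_words n" "a = braid_rel n `` {u}" by (rule braid_class_cases)
  show "\<one>\<^bsub>braid_group n\<^esub> \<otimes>\<^bsub>braid_group n\<^esub> a = a"
    unfolding one u(2) by (subst braid_mult) (auto simp: u(1))
  show "\<exists>b\<in>carrier (braid_group n). b \<otimes>\<^bsub>braid_group n\<^esub> a = \<one>\<^bsub>braid_group n\<^esub>"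
    using u braid_class_in[of "braid_inverse u" n] braid_mult[of "braid_inverse u" n u]
      braid_eq_class[OF braid_inverse_cancel[OF u(1)]] one by auto
  fix b assume "b \<in> carrier (braid_group n)"
  then obtain v where v: "v \<in> braid_words n" "b = braid_rel n `` {v}" by (rule braid_class_cases)
  show "a \<otimes>\<^bsub>braid_group n\<^esub> b \<in> carrier (braid_group n)"
    using u v by (simp add: braid_mult braid_class_in)
  fix c assume "c \<in> carrier (braid_group n)"
  then obtain w where w: "w \<in> braid_words n" "c = braid_rel n `` {w}" by (rule braid_class_cases)
  show "a \<otimes>\<^bsub>braid_group n\<^esub> b \<otimes>\<^bsub>braid_group n\<^esub> c =
    a \<otimes>\<^bsub>braid_group n\<^esub> (b \<otimes>\<^bsub>braid_group n\<^esub> c)"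
    using u v w by (simp add: braid_mult)
qed

lemma hurwitz_word_Nil [simp]: "hurwitz_word G [] xs = xs"
  by (simp add: hurwitz_word_def)

lemma hurwitz_word_Cons [simp]: "hurwitz_word G (p # w) xs = hurwitz_letter G p (hurwitz_word G w xs)"
  by (simp add: hurwitz_word_def)

lemma hurwitz_word_append: "hurwitz_word G (u @ v) xs = hurwitz_word G u (hurwitz_word G v xs)"
  by (simp add: hurwitz_word_def)

lemma hurwitz_letter_True:
  "i = Suc (length us) \<Longrightarrow>
   hurwitz_letter G (i, True) (us @ a # b # vs) = us @ a \<otimes>\<^bsub>G\<^esub> b \<otimes>\<^bsub>G\<^esub> inv\<^bsub>G\<^esub> a # a # vs"
  by (simp add: hurwitz_letter.simps nth_append list_update_append Let_def)

lemma hurwitz_letter_False: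
  "i = Suc (length us) \<Longrightarrow>
   hurwitz_letter G (i, False) (us @ a # b # vs) = us @ b # inv\<^bsub>G\<^esub> b \<otimes>\<^bsub>G\<^esub> a \<otimes>\<^bsub>G\<^esub> b # vs"
  by (simp add: hurwitz_letter.simps nth_append list_update_append Let_def)

lemma split_at_two:
  assumes "i \<in> {1..<length xs}"
  obtains us a b vs where "xs = us @ a # b # vs" "i = Suc (length us)"
proof -
  have "xs = take (i - 1) xs @ xs ! (i - 1) # xs ! i # drop (Suc i) xs"
  proof -
    have "i - 1 < length xs" "Suc (i - 1) = i" "i < length xs" using assms by auto
    then show ?thesis
      using id_take_nth_drop[of "i - 1" xs] Cons_nth_drop_Suc[of i xs] by metis
  qed
  moreover have "i = Suc (length (take (i - 1) xs))" using assms by auto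
  ultimately show thesis by (rule that)
qed

context group begin

lemma inv_assoc_cancel:
  assumes "a \<in> carrier G" "x \<in> carrier G"
  shows "inv a \<otimes> (a \<otimes> x) = x" "a \<otimes> (inv a \<otimes> x) = x"
  by (metis assms inv_closed l_inv l_one m_assoc) (metis assms inv_closed r_inv l_one m_assoc)

lemma conj_cancel:
  assumes "a \<in> carrier G" "b \<in> carrier G"
  shows "inv a \<otimes> (a \<otimes> b \<otimes> inv a) \<otimes> a = b" "a \<otimes> (inv a \<otimes> b \<otimes> a) \<otimes> inv a = b"
proof -
  show "inv a \<otimes> (a \<otimes> b \<otimes> inv a) \<otimes> a = b" "a \<otimes> (inv a \<otimes> b \<otimes> a) \<otimes> inv a = b"
    using assms by (simp_all add: m_assoc inv_assoc_cancel)
qed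

lemma tuples_split:
  assumes "i \<in> {1..<n}" "xs \<in> tuples G n"
  obtains us a b vs where "xs = us @ a # b # vs" "i = Suc (length us)"
proof (rule split_at_two)
  show "i \<in> {1..<length xs}" using assms by (simp add: tuples_def)
qed (rule that)

lemma hurwitz_letter_tuples:
  assumes "i \<in> {1..<n}" "xs \<in> tuples G n"
  shows "hurwitz_letter G (i, e) xs \<in> tuples G n"
proof -
  obtain us a b vs where *: "xs = us @ a # b # vs" "i = Suc (length us)"
    by (rule tuples_split[OF assms])
  have abn: "a \<in> carrier G" "b \<in> carrier G" "set us \<subseteq> carrier G" "set vs \<subseteq> carrier G"
    "n = Suc (Suc (length us + length vs))"
    using assms(2) *(1) by (auto simp: tuples_def)
  then show ?thesis
    by (cases e) (simp_all add: *(1) hurwitz_letter_True[OF *(2)] hurwitz_letter_False[OF *(2)] tuples_def)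
qed

lemma hurwitz_word_tuples:
  "w \<in> braid_words n \<Longrightarrow> xs \<in> tuples G n \<Longrightarrow> hurwitz_word G w xs \<in> tuples G n"
proof (induction w)
  case (Cons p w)
  obtain i e where "p = (i, e)" by (cases p)
  then show ?case using Cons hurwitz_letter_tuples by simp
qed simp

lemma hurwitz_letter_cancel:
  assumes "i \<in> {1..<n}" "xs \<in> tuples G n"
  shows "hurwitz_letter G (i, e) (hurwitz_letter G (i, \<not> e) xs) = xs"
proof -
  obtain us a b vs where *: "xs = us @ a # b # vs" "i = Suc (length us)"
    by (rule tuples_split[OF assms])
  have "a \<in> carrier G" "b \<in> carrier G" using assms(2) * by (auto simp: tuples_def)
  then show ?thesis
    by (cases e) (simp_all add: *(1) hurwitz_letter_True[OF *(2)] hurwitz_letter_False[OF *(2)] conj_cancel)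
qed

lemma hurwitz_letter_far:
  assumes "i \<in> {1..<n}" "j \<in> {1..<n}" "i + 2 \<le> j" "xs \<in> tuples G n"
  shows "hurwitz_letter G (i, True) (hurwitz_letter G (j, True) xs) =
         hurwitz_letter G (j, True) (hurwitz_letter G (i, True) xs)"
  using assms by (simp add: hurwitz_letter.simps tuples_def Let_def list_update_swap)

lemma hurwitz_letter_braid:
  assumes "i \<in> {1..<n}" "i + 1 \<in> {1..<n}" "xs \<in> tuples G n"
  shows "hurwitz_letter G (i, True) (hurwitz_letter G (i + 1, True) (hurwitz_letter G (i, True) xs)) =
         hurwitz_letter G (i + 1, True) (hurwitz_letter G (i, True) (hurwitz_letter G (i + 1, True) xs))"
proof -
  obtain us a b vs where *: "xs = us @ a # b # vs" "i = Suc (length us)"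
    by (rule tuples_split[OF assms(1,3)])
  obtain c ws where vs: "vs = c # ws"
    using assms * by (cases vs) (auto simp: tuples_def)
  have abc: "a \<in> carrier G" "b \<in> carrier G" "c \<in> carrier G"
    using assms(3) * vs by (auto simp: tuples_def)
  have 1: "hurwitz_letter G (Suc i, True) (us @ x # y # z # ws) =
      us @ x # y \<otimes> z \<otimes> inv y # y # ws" for x y z
    using hurwitz_letter_True[of "Suc i" "us @ [x]" G y z ws] *(2) by simp
  have "a \<otimes> b \<otimes> inv a \<otimes> (a \<otimes> c \<otimes> inv a) \<otimes> inv (a \<otimes> b \<otimes> inv a) =
        a \<otimes> (b \<otimes> c \<otimes> inv b) \<otimes> inv a"
    using abc by (simp add: inv_mult_group m_assoc inv_assoc_cancel)
  then show ?thesis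
    by (simp add: hurwitz_letter_True 1 *(1) *(2)[symmetric] vs)
qed

lemma hurwitz_word_braid_eq:
  "braid_eq n u v \<Longrightarrow> xs \<in> tuples G n \<Longrightarrow> hurwitz_word G u xs = hurwitz_word G v xs"
proof (induction arbitrary: xs rule: braid_eq.induct)
  case (append u u' v v')
  then show ?case
    using hurwitz_word_tuples braid_eq_words by (simp add: hurwitz_word_append)
next
  case (cancel i e)
  then show ?case using hurwitz_letter_cancel by (simp)
next
  case (far i j)
  then show ?case using hurwitz_letter_far by (simp)
next
  case (braid i)
  then show ?case using hurwitz_letter_braid by (simp)
qed auto

lemma hurwitz_action_class:
  assumes "w \<in> braid_words n" "xs \<in> tuples G n"
  shows "hurwitz_action G n (braid_rel n `` {w}) xs = hurwitz_word G w xs"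
proof -
  have "w \<in> braid_rel n `` {w}" using assms by (simp add: braid_rel_def braid_eq.refl)
  then have "(SOME v. v \<in> braid_rel n `` {w}) \<in> braid_rel n `` {w}" by (rule someI)
  then show ?thesis
    using assms by (simp add: hurwitz_action_def braid_rel_def hurwitz_word_braid_eq)
qed

theorem group_action_hurwitz:
  "group_action (braid_group n) (tuples G n) (hurwitz_action G n)"
proof -
  interpret B: group "braid_group n" by (rule group_braid_group)
  have closed: "hurwitz_action G n b xs \<in> tuples G n"
    if "b \<in> carrier (braid_group n)" "xs \<in> tuples G n" for b xs
    using that by (elim braid_class_cases) (simp add: hurwitz_action_class hurwitz_word_tuples)
  have mult: "hurwitz_action G n (a \<otimes>\<^bsub>braid_group n\<^esub> b) xs =
      hurwitz_action G n a (hurwitz_action G n b xs)"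
    if "a \<in> carrier (braid_group n)" "b \<in> carrier (braid_group n)" "xs \<in> tuples G n" for a b xs
    using that by (elim braid_class_cases)
      (simp add: braid_mult hurwitz_action_class hurwitz_word_tuples hurwitz_word_append)
  have one: "hurwitz_action G n \<one>\<^bsub>braid_group n\<^esub> xs = xs" if "xs \<in> tuples G n" for xs
    using hurwitz_action_class[of "[]" n xs] that by (simp add: braid_group_def)
  have Bij: "hurwitz_action G n b \<in> Bij (tuples G n)" if b: "b \<in> carrier (braid_group n)" for b
  proof -
    have "bij_betw (hurwitz_action G n b) (tuples G n) (tuples G n)"
      by (rule bij_betw_byWitness[where f' = "hurwitz_action G n (inv\<^bsub>braid_group n\<^esub> b)"])
         (auto simp: b closed mult[symmetric] one)
    then show ?thesis by (simp add: Bij_def hurwitz_action_def)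
  qed
  have "hurwitz_action G n (a \<otimes>\<^bsub>braid_group n\<^esub> b) =
      compose (tuples G n) (hurwitz_action G n a) (hurwitz_action G n b)"
    if "a \<in> carrier (braid_group n)" "b \<in> carrier (braid_group n)" for a b
    by (rule extensionalityI[where A = "tuples G n"])
       (auto simp: hurwitz_action_def[of G n "a \<otimes>\<^bsub>braid_group n\<^esub> b"] compose_eq mult[OF that, symmetric])
  then show ?thesis
    unfolding group_action_def group_hom_def group_hom_axioms_def hom_def
    using Bij group_BijGroup[of "tuples G n"] by (auto simp: group_braid_group BijGroup_def)
qed

end


section \<open>Components form a commutative monoid\<close>

context group begin

lemma hurwitz_orbit_eq:
  assumes "xs \<in> tuples G n"
  shows "hurwitz_orbit G xs = {hurwitz_word G w xs |w. w \<in> braid_words n}"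
proof -
  have n: "length xs = n" using assms by (simp add: tuples_def)
  have "\<exists>w. hurwitz_action G n b xs = hurwitz_word G w xs \<and> w \<in> braid_words n"
    if "b \<in> carrier (braid_group n)" for b
    using that assms by (elim braid_class_cases) (auto simp: hurwitz_action_class)
  moreover have "\<exists>b. hurwitz_word G w xs = hurwitz_action G n b xs \<and> b \<in> carrier (braid_group n)"
    if "w \<in> braid_words n" for w
    using that assms braid_class_in hurwitz_action_class[of w n xs] by metis
  ultimately show ?thesis
    unfolding hurwitz_orbit_def orbit_def n by blast
qed

lemma hurwitz_orbit_tuples:
  "xs \<in> tuples G n \<Longrightarrow> ys \<in> hurwitz_orbit G xs \<Longrightarrow> ys \<in> tuples G n"
  using hurwitz_word_tuples by (auto simp: hurwitz_orbit_eq)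

lemma hurwitz_orbit_refl: "xs \<in> tuples G n \<Longrightarrow> xs \<in> hurwitz_orbit G xs"
  by (auto simp: hurwitz_orbit_eq intro: exI[of _ "[]"])

lemma hurwitz_orbit_class:
  assumes "xs \<in> tuples G n" "ys \<in> hurwitz_orbit G xs"
  shows "hurwitz_orbit G ys = hurwitz_orbit G xs"
proof -
  interpret A: group_action "braid_group n" "tuples G n" "hurwitz_action G n"
    by (rule group_action_hurwitz)
  have ys: "ys \<in> tuples G n" using assms hurwitz_orbit_tuples by blast
  have len: "length xs = n" "length ys = n" using assms(1) ys by (auto simp: tuples_def)
  have 1: "ys \<in> orbit (braid_group n) (hurwitz_action G n) xs"
    using assms(2) by (simp add: hurwitz_orbit_def len)
  have *: "zs \<in> tuples G n" if "x \<in> tuples G n" "zs \<in> orbit (braid_group n) (hurwitz_action G n) x" for x zs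
    using that A.element_image by (auto simp: orbit_def)
  show ?thesis
    unfolding hurwitz_orbit_def len
    using A.orbit_sym[OF assms(1) ys 1] A.orbit_trans * 1 assms(1) ys by blast
qed

lemma hurwitz_orbit_sym:
  "xs \<in> tuples G n \<Longrightarrow> ys \<in> hurwitz_orbit G xs \<Longrightarrow> xs \<in> hurwitz_orbit G ys"
  using hurwitz_orbit_class hurwitz_orbit_refl by blast

lemma hurwitz_orbit_induct [consumes 2, case_names refl letter]:
  assumes "ys \<in> hurwitz_orbit G xs" "xs \<in> tuples G n"
    and "P xs"
    and "\<And>zs i e. zs \<in> tuples G n \<Longrightarrow> i \<in> {1..<n} \<Longrightarrow> P zs \<Longrightarrow> P (hurwitz_letter G (i, e) zs)"
  shows "P ys"
proof -
  have "P (hurwitz_word G w xs)" if "w \<in> braid_words n" for w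
    using that
  proof (induction w)
    case (Cons p w)
    obtain i e where "p = (i, e)" by (cases p)
    then show ?case using Cons assms(4) hurwitz_word_tuples assms(2) by simp
  qed (simp add: assms(3))
  then show ?thesis using assms(1,2) by (auto simp: hurwitz_orbit_eq)
qed

lemma foldr_mult_closed: "set xs \<subseteq> carrier G \<Longrightarrow> foldr (\<otimes>) xs \<one> \<in> carrier G"
  by (induction xs) auto

lemma foldr_mult_append:
  "set xs \<subseteq> carrier G \<Longrightarrow> set ys \<subseteq> carrier G \<Longrightarrow>
   foldr (\<otimes>) (xs @ ys) \<one> = foldr (\<otimes>) xs \<one> \<otimes> foldr (\<otimes>) ys \<one>"
  by (induction xs) (auto simp: m_assoc foldr_mult_closed simp del: foldr_append)

lemma hurwitz_letter_product:
  assumes "xs \<in> tuples G n" "i \<in> {1..<n}"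
  shows "foldr (\<otimes>) (hurwitz_letter G (i, e) xs) \<one> = foldr (\<otimes>) xs \<one>"
proof -
  obtain us a b vs where *: "xs = us @ a # b # vs" "i = Suc (length us)"
    by (rule tuples_split[OF assms(2,1)])
  have abn: "a \<in> carrier G" "b \<in> carrier G" "set us \<subseteq> carrier G" "set vs \<subseteq> carrier G"
    using assms(1) *(1) by (auto simp: tuples_def)
  then show ?thesis
    by (cases e) (simp_all add: *(1) hurwitz_letter_True[OF *(2)] hurwitz_letter_False[OF *(2)]
      foldr_mult_append foldr_mult_closed m_assoc inv_assoc_cancel del: foldr_append)
qed

lemma hurwitz_orbit_product:
  assumes "xs \<in> tuples G n" "ys \<in> hurwitz_orbit G xs"
  shows "foldr (\<otimes>) ys \<one> = foldr (\<otimes>) xs \<one>"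
  using assms(2,1) by (induction rule: hurwitz_orbit_induct) (simp_all add: hurwitz_letter_product)

lemma conjugacy_class_conj:
  assumes "\<gamma> \<in> conjugacy_classes G" "a \<in> carrier G" "b \<in> carrier G"
  shows "a \<otimes> b \<otimes> inv a \<in> \<gamma> \<longleftrightarrow> b \<in> \<gamma>"
proof -
  obtain x where x: "x \<in> carrier G" "\<gamma> = {g \<otimes> x \<otimes> inv g |g. g \<in> carrier G}"
    using assms(1) by (auto simp: conjugacy_classes_def orbits_def orbit_def)
  have 1: "c \<otimes> y \<otimes> inv c \<in> \<gamma>" if yc: "y \<in> \<gamma>" "c \<in> carrier G" for y c
  proof -
    obtain g where "g \<in> carrier G" "y = g \<otimes> x \<otimes> inv g" using yc x by auto
    then have "c \<otimes> g \<in> carrier G" "c \<otimes> y \<otimes> inv c = c \<otimes> g \<otimes> x \<otimes> inv (c \<otimes> g)"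
      using yc x by (auto simp: inv_mult_group m_assoc)
    then show ?thesis using x(2) by auto
  qed
  have "inv a \<otimes> (a \<otimes> b \<otimes> inv a) \<otimes> inv (inv a) = b"
    using assms by (simp add: conj_cancel)
  then show ?thesis using 1[of b a] 1[of "a \<otimes> b \<otimes> inv a" "inv a"] assms by auto
qed

lemma hurwitz_orbit_count:
  assumes "xs \<in> tuples G n" "ys \<in> hurwitz_orbit G xs" "\<gamma> \<in> conjugacy_classes G"
  shows "length (filter (\<lambda>g. g \<in> \<gamma>) ys) = length (filter (\<lambda>g. g \<in> \<gamma>) xs)"
  using assms(2,1)
proof (induction rule: hurwitz_orbit_induct)
  case (letter zs i e)
  obtain us a b vs where *: "zs = us @ a # b # vs" "i = Suc (length us)"
    by (rule tuples_split[OF letter(2,1)])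
  have ab: "a \<in> carrier G" "b \<in> carrier G"
    using letter(1) *(1) by (auto simp: tuples_def)
  have "inv b \<otimes> a \<otimes> b \<in> \<gamma> \<longleftrightarrow> a \<in> \<gamma>"
    using conjugacy_class_conj[OF assms(3), of "inv b" a] ab by simp
  then have "length (filter (\<lambda>g. g \<in> \<gamma>) (hurwitz_letter G (i, e) zs)) = length (filter (\<lambda>g. g \<in> \<gamma>) zs)"
    using ab conjugacy_class_conj[OF assms(3)]
    by (cases e) (simp_all add: *(1) hurwitz_letter_True[OF *(2)] hurwitz_letter_False[OF *(2)])
  then show ?case using letter by simp
qed simp

lemma hurwitz_orbit_generate_subset:
  assumes "xs \<in> tuples G n" "ys \<in> hurwitz_orbit G xs"
  shows "set ys \<subseteq> generate G (set xs)"
  using assms(2,1)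
proof (induction rule: hurwitz_orbit_induct)
  case refl
  then show ?case by (auto intro: generate.incl)
next
  case (letter zs i e)
  have "set xs \<subseteq> carrier G" using assms by (simp add: tuples_def)
  then interpret H: subgroup "generate G (set xs)" G by (rule generate_is_subgroup)
  obtain us a b vs where *: "zs = us @ a # b # vs" "i = Suc (length us)"
    by (rule tuples_split[OF letter(2,1)])
  show ?case using letter(3)
    by (cases e) (auto simp: *(1) hurwitz_letter_True[OF *(2)] hurwitz_letter_False[OF *(2)])
qed

lemma component_group_eq:
  assumes "xs \<in> tuples G n" "ys \<in> hurwitz_orbit G xs"
  shows "component_group G (hurwitz_orbit G xs) = generate G (set ys)"
proof -
  have *: "generate G (set zs) = generate G (set xs)" if "zs \<in> hurwitz_orbit G xs" for zs
  proof
    have zs: "zs \<in> tuples G n" using that assms hurwitz_orbit_tuples by blast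
    show "generate G (set zs) \<subseteq> generate G (set xs)"
      using hurwitz_orbit_generate_subset[OF assms(1) that] assms(1)
      by (intro generate_subgroup_incl generate_is_subgroup) (auto simp: tuples_def)
    show "generate G (set xs) \<subseteq> generate G (set zs)"
      using hurwitz_orbit_generate_subset[OF zs hurwitz_orbit_sym[OF assms(1) that]] zs
      by (intro generate_subgroup_incl generate_is_subgroup) (auto simp: tuples_def)
  qed
  have "(SOME zs. zs \<in> hurwitz_orbit G xs) \<in> hurwitz_orbit G xs"
    using assms(2) by (rule someI)
  then show ?thesis by (simp add: component_group_def * assms(2))
qed

lemma hurwitz_letter_context:
  assumes "xs \<in> tuples G n" "i \<in> {1..<n}"
  shows "hurwitz_letter G (i + length us, e) (us @ xs @ vs) = us @ hurwitz_letter G (i, e) xs @ vs"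
proof -
  obtain ys a b zs where *: "xs = ys @ a # b # zs" "i = Suc (length ys)"
    by (rule tuples_split[OF assms(2,1)])
  have k: "i + length us = Suc (length (us @ ys))" using * by simp
  show ?thesis
    using hurwitz_letter_True[OF k, of G a b "zs @ vs"] hurwitz_letter_False[OF k, of G a b "zs @ vs"]
    by (cases e) (simp_all add: *(1) hurwitz_letter_True[OF *(2)] hurwitz_letter_False[OF *(2)])
qed

lemma tuples_append:
  "xs \<in> tuples G n \<Longrightarrow> ys \<in> tuples G m \<Longrightarrow> xs @ ys \<in> tuples G (n + m)"
  by (auto simp: tuples_def)

lemma hurwitz_orbit_letter:
  assumes "xs \<in> tuples G n" "i \<in> {1..<n}"
  shows "hurwitz_letter G (i, e) xs \<in> hurwitz_orbit G xs"
  unfolding hurwitz_orbit_eq[OF assms(1)] using assms(2)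
  by (auto intro!: exI[of _ "[(i, e)]"])

lemma hurwitz_orbit_trans:
  "xs \<in> tuples G n \<Longrightarrow> ys \<in> hurwitz_orbit G xs \<Longrightarrow> zs \<in> hurwitz_orbit G ys \<Longrightarrow> zs \<in> hurwitz_orbit G xs"
  by (simp add: hurwitz_orbit_class)

lemma hurwitz_orbit_context:
  assumes "xs \<in> tuples G n" "ys \<in> hurwitz_orbit G xs" "us \<in> tuples G k" "vs \<in> tuples G l"
  shows "us @ ys @ vs \<in> hurwitz_orbit G (us @ xs @ vs)"
  using assms(2,1)
proof (induction rule: hurwitz_orbit_induct)
  case refl
  have "us @ xs @ vs \<in> tuples G (k + (n + l))"
    using assms by (intro tuples_append)
  then show ?case by (rule hurwitz_orbit_refl)
next
  case (letter zs i e)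
  have t: "us @ zs @ vs \<in> tuples G (k + (n + l))" "us @ xs @ vs \<in> tuples G (k + (n + l))"
    using assms letter(1) by (auto intro!: tuples_append)
  have "i + length us \<in> {1..<k + (n + l)}"
    using letter(2) assms(3) by (auto simp: tuples_def)
  from hurwitz_orbit_letter[OF t(1) this, of e] show ?case
    unfolding hurwitz_letter_context[OF letter(1,2)]
    using hurwitz_orbit_trans[OF t(2) letter(3)] by blast
qed

lemma hurwitz_orbit_append:
  assumes "xs \<in> tuples G n" "xs' \<in> hurwitz_orbit G xs" "ys \<in> tuples G m" "ys' \<in> hurwitz_orbit G ys"
  shows "hurwitz_orbit G (xs' @ ys') = hurwitz_orbit G (xs @ ys)"
proof -
  have nil: "[] \<in> tuples G 0" by (simp add: tuples_def)
  have xs': "xs' \<in> tuples G n" using assms hurwitz_orbit_tuples by blast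
  have "xs' @ ys \<in> hurwitz_orbit G (xs @ ys)"
    using hurwitz_orbit_context[OF assms(1,2) nil assms(3)] by simp
  moreover have "xs' @ ys' \<in> hurwitz_orbit G (xs' @ ys)"
    using hurwitz_orbit_context[OF assms(3,4) xs' nil] by simp
  ultimately show ?thesis
    using hurwitz_orbit_class tuples_append assms(1,3) xs' by metis
qed

lemma hurwitz_orbit_swap:
  assumes "a \<in> carrier G" "set ys \<subseteq> carrier G"
  shows "map (\<lambda>b. a \<otimes> b \<otimes> inv a) ys @ [a] \<in> hurwitz_orbit G (a # ys)"
  using assms(2)
proof (induction ys)
  case Nil
  then show ?case using assms(1) hurwitz_orbit_refl[of "[a]" 1] by (simp add: tuples_def)
next
  case (Cons b ys)
  let ?c = "a \<otimes> b \<otimes> inv a"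
  have t: "a # b # ys \<in> tuples G (Suc (Suc (length ys)))" "a # ys \<in> tuples G (Suc (length ys))"
    "[?c] \<in> tuples G 1" "[] \<in> tuples G 0"
    using Cons assms by (auto simp: tuples_def)
  have "?c # a # ys \<in> hurwitz_orbit G (a # b # ys)"
    using hurwitz_orbit_letter[OF t(1), of 1 True] hurwitz_letter_True[of 1 "[]" G a b ys] by simp
  moreover have "?c # map (\<lambda>b. a \<otimes> b \<otimes> inv a) ys @ [a] \<in> hurwitz_orbit G (?c # a # ys)"
    using hurwitz_orbit_context[OF t(2) Cons.IH t(3,4)] Cons.prems by simp
  ultimately show ?case using hurwitz_orbit_trans[OF t(1)] by simp
qed

lemma hurwitz_orbit_swap_block:
  assumes "set xs \<subseteq> carrier G" "set ys \<subseteq> carrier G"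
  shows "map (\<lambda>b. foldr (\<otimes>) xs \<one> \<otimes> b \<otimes> inv (foldr (\<otimes>) xs \<one>)) ys @ xs \<in> hurwitz_orbit G (xs @ ys)"
  using assms(1)
proof (induction xs)
  case Nil
  have "map (\<lambda>b. \<one> \<otimes> b \<otimes> inv \<one>) ys = ys"
    using assms(2) by (intro map_idI) auto
  then show ?case using assms(2) hurwitz_orbit_refl[of ys "length ys"] by (simp add: tuples_def)
next
  case (Cons a xs)
  define p where "p = foldr (\<otimes>) xs \<one>"
  define zs where "zs = map (\<lambda>b. p \<otimes> b \<otimes> inv p) ys"
  have p: "p \<in> carrier G" using Cons.prems foldr_mult_closed by (simp add: p_def)
  have zs: "set zs \<subseteq> carrier G" using assms(2) p by (auto simp: zs_def)
  have t: "xs @ ys \<in> tuples G (length xs + length ys)" "[a] \<in> tuples G 1" "[] \<in> tuples G 0"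
    "a # zs \<in> tuples G (Suc (length zs))" "xs \<in> tuples G (length xs)"
    "a # xs @ ys \<in> tuples G (Suc (length xs + length ys))"
    using Cons.prems assms(2) zs by (auto simp: tuples_def)
  have IH: "zs @ xs \<in> hurwitz_orbit G (xs @ ys)" using Cons by (simp add: zs_def p_def)
  have 1: "a # zs @ xs \<in> hurwitz_orbit G (a # xs @ ys)"
    using hurwitz_orbit_context[OF t(1) IH t(2,3)] by simp
  have "a \<in> carrier G" using Cons.prems by simp
  from hurwitz_orbit_context[OF t(4) hurwitz_orbit_swap[OF this zs] t(3,5)]
  have 2: "map (\<lambda>b. a \<otimes> b \<otimes> inv a) zs @ a # xs \<in> hurwitz_orbit G (a # zs @ xs)" by simp
  have "map (\<lambda>b. a \<otimes> b \<otimes> inv a) zs = map (\<lambda>b. (a \<otimes> p) \<otimes> b \<otimes> inv (a \<otimes> p)) ys"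
    using \<open>a \<in> carrier G\<close> p assms(2) by (auto simp: zs_def inv_mult_group m_assoc)
  then show ?case
    using hurwitz_orbit_trans[OF t(6) 1 2] by (simp add: p_def)
qed

lemma hurwitz_orbit_commute:
  assumes "xs \<in> tuples G n" "ys \<in> tuples G m" "foldr (\<otimes>) xs \<one> = \<one>"
  shows "hurwitz_orbit G (ys @ xs) = hurwitz_orbit G (xs @ ys)"
proof -
  have c: "set xs \<subseteq> carrier G" "set ys \<subseteq> carrier G" using assms by (auto simp: tuples_def)
  have "map (\<lambda>b. \<one> \<otimes> b \<otimes> inv \<one>) ys = ys"
    using c by (intro map_idI) auto
  then have "ys @ xs \<in> hurwitz_orbit G (xs @ ys)"
    using hurwitz_orbit_swap_block[OF c] assms(3) by simp
  then show ?thesis using hurwitz_orbit_class tuples_append assms by blast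
qed

lemma Comp_mult:
  assumes "xs \<in> tuples G n" "ys \<in> tuples G m"
  shows "hurwitz_orbit G xs \<otimes>\<^bsub>Comp G D \<xi>\<^esub> hurwitz_orbit G ys = hurwitz_orbit G (xs @ ys)"
proof -
  have "(\<Union>x\<in>hurwitz_orbit G xs. \<Union>y\<in>hurwitz_orbit G ys. hurwitz_orbit G (x @ y)) =
      (\<Union>x\<in>hurwitz_orbit G xs. \<Union>y\<in>hurwitz_orbit G ys. hurwitz_orbit G (xs @ ys))"
    by (intro SUP_cong HOL.refl hurwitz_orbit_append[OF assms(1) _ assms(2)])
  also have "\<dots> = hurwitz_orbit G (xs @ ys)"
    using assms[THEN hurwitz_orbit_refl] by auto
  finally show ?thesis by (simp add: Comp_def)
qed

lemma Comp_carrier: "carrier (Comp G D \<xi>) = (\<Union>n. hurwitz_orbit G ` component_tuples G D \<xi> n)"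
  by (simp add: Comp_def components_of_degree_def)

lemma component_tuples_append:
  assumes "xs \<in> component_tuples G D \<xi> n" "ys \<in> component_tuples G D \<xi> m"
  shows "xs @ ys \<in> component_tuples G D \<xi> (n + m)"
  using assms foldr_mult_append[of xs ys]
  by (auto simp: component_tuples_def tuples_def algebra_simps simp del: foldr_append)

lemma component_tuples_in: "xs \<in> component_tuples G D \<xi> n \<Longrightarrow> xs \<in> tuples G (n * (\<Sum>\<gamma>\<in>D. \<xi> \<gamma>))"
  by (simp add: component_tuples_def)

theorem comm_monoid_Comp: "comm_monoid (Comp G D \<xi>)"
proof (rule comm_monoidI)
  have one: "\<one>\<^bsub>Comp G D \<xi>\<^esub> = hurwitz_orbit G []" by (simp add: Comp_def)
  have nil: "[] \<in> component_tuples G D \<xi> 0" by (simp add: component_tuples_def tuples_def)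
  show "\<one>\<^bsub>Comp G D \<xi>\<^esub> \<in> carrier (Comp G D \<xi>)"
    using nil unfolding one Comp_carrier by blast
  fix A assume "A \<in> carrier (Comp G D \<xi>)"
  then obtain x n where x: "x \<in> component_tuples G D \<xi> n" "A = hurwitz_orbit G x"
    by (auto simp: Comp_carrier)
  show "\<one>\<^bsub>Comp G D \<xi>\<^esub> \<otimes>\<^bsub>Comp G D \<xi>\<^esub> A = A"
    unfolding one x(2) using Comp_mult[OF component_tuples_in[OF nil] component_tuples_in[OF x(1)]] by simp
  fix B assume "B \<in> carrier (Comp G D \<xi>)"
  then obtain y m where y: "y \<in> component_tuples G D \<xi> m" "B = hurwitz_orbit G y"
    by (auto simp: Comp_carrier)
  note t = component_tuples_in[OF x(1)] component_tuples_in[OF y(1)]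
  have AB: "A \<otimes>\<^bsub>Comp G D \<xi>\<^esub> B = hurwitz_orbit G (x @ y)"
    by (simp add: x(2) y(2) Comp_mult[OF t])
  show "A \<otimes>\<^bsub>Comp G D \<xi>\<^esub> B \<in> carrier (Comp G D \<xi>)"
    unfolding AB Comp_carrier using component_tuples_append[OF x(1) y(1)] by blast
  show "A \<otimes>\<^bsub>Comp G D \<xi>\<^esub> B = B \<otimes>\<^bsub>Comp G D \<xi>\<^esub> A"
    unfolding AB unfolding x(2) y(2) Comp_mult[OF t(2,1)]
    using hurwitz_orbit_commute[OF t] x(1) by (simp add: component_tuples_def)
  fix C assume "C \<in> carrier (Comp G D \<xi>)"
  then obtain z k where z: "z \<in> component_tuples G D \<xi> k" "C = hurwitz_orbit G z"
    by (auto simp: Comp_carrier)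
  show "A \<otimes>\<^bsub>Comp G D \<xi>\<^esub> B \<otimes>\<^bsub>Comp G D \<xi>\<^esub> C = A \<otimes>\<^bsub>Comp G D \<xi>\<^esub> (B \<otimes>\<^bsub>Comp G D \<xi>\<^esub> C)"
    unfolding AB z(2)
    unfolding Comp_mult[OF tuples_append[OF t] component_tuples_in[OF z(1)]]
    unfolding x(2) y(2) Comp_mult[OF t(2) component_tuples_in[OF z(1)]]
    unfolding Comp_mult[OF t(1) tuples_append[OF t(2) component_tuples_in[OF z(1)]]]
    by simp
qed

end


section \<open>The monoid ring is a commutative ring\<close>

context cring begin

lemma finsum_swap:
  assumes "finite A" "finite B" "\<And>a b. a \<in> A \<Longrightarrow> b \<in> B \<Longrightarrow> h a b \<in> carrier R"
  shows "(\<Oplus>a\<in>A. \<Oplus>b\<in>B. h a b) = (\<Oplus>b\<in>B. \<Oplus>a\<in>A. h a b)"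
  using assms(1,3)
proof (induction A)
  case empty
  then show ?case by (simp add: finsum_zero)
next
  case (insert x A)
  then have "(\<Oplus>b\<in>B. \<Oplus>a\<in>insert x A. h a b) = (\<Oplus>b\<in>B. h x b \<oplus> (\<Oplus>a\<in>A. h a b))"
    by (intro finsum_cong') (auto intro!: finsum_closed)
  also have "\<dots> = (\<Oplus>b\<in>B. h x b) \<oplus> (\<Oplus>b\<in>B. \<Oplus>a\<in>A. h a b)"
    using insert by (intro finsum_addf) (auto intro!: finsum_closed)
  also have "\<dots> = (\<Oplus>a\<in>insert x A. \<Oplus>b\<in>B. h a b)"
    using insert by (simp add: finsum_closed Pi_def)
  finally show ?case by simp
qed

lemma finsum_times:
  assumes "finite A" "finite B" "\<And>a b. a \<in> A \<Longrightarrow> b \<in> B \<Longrightarrow> h a b \<in> carrier R"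
  shows "(\<Oplus>p\<in>A \<times> B. h (fst p) (snd p)) = (\<Oplus>a\<in>A. \<Oplus>b\<in>B. h a b)"
  using assms(1,3)
proof (induction A)
  case empty
  then show ?case by simp
next
  case (insert x A)
  have "insert x A \<times> B = Pair x ` B \<union> A \<times> B" by auto
  then have "(\<Oplus>p\<in>insert x A \<times> B. h (fst p) (snd p)) =
      (\<Oplus>p\<in>Pair x ` B. h (fst p) (snd p)) \<oplus> (\<Oplus>p\<in>A \<times> B. h (fst p) (snd p))"
    using insert assms(2) by (simp only:) (rule finsum_Un_disjoint; auto)
  also have "(\<Oplus>p\<in>Pair x ` B. h (fst p) (snd p)) = (\<Oplus>b\<in>B. h x b)"
    using insert by (subst finsum_reindex) (auto simp: inj_on_def)
  finally show ?case using insert by (simp add: finsum_closed Pi_def)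
qed

lemma finsum_delta:
  assumes "finite A" "x \<in> A" "c \<in> carrier R"
  shows "(\<Oplus>a\<in>A. if x = a then c else \<zero>) = c"
  using add.finprod_singleton[OF assms(2,1), of "\<lambda>_. c"] assms(3) by simp

lemma monoid_ring_carrier:
  "f \<in> carrier (monoid_ring R M) \<longleftrightarrow>
     (\<forall>m. f m \<in> carrier R) \<and> {m. f m \<noteq> \<zero>} \<subseteq> carrier M \<and> finite {m. f m \<noteq> \<zero>}"
proof -
  have "f \<in> carrier (monoid_ring R M) \<longleftrightarrow> (\<forall>m\<in>carrier M. f m \<in> carrier R) \<and>
      (\<forall>m. m \<notin> carrier M \<longrightarrow> f m = \<zero>) \<and> finite {m. f m \<noteq> \<zero>}"
    by (simp add: monoid_ring_def)
  moreover have "f m \<in> carrier R"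
    if "\<forall>m\<in>carrier M. f m \<in> carrier R" "\<forall>m. m \<notin> carrier M \<longrightarrow> f m = \<zero>" for m
    using that by (cases "m \<in> carrier M") auto
  ultimately show ?thesis by blast
qed

lemma monoid_ring_simps [simp]:
  "\<one>\<^bsub>monoid_ring R M\<^esub> = (\<lambda>m. if m = \<one>\<^bsub>M\<^esub> then \<one> else \<zero>)"
  "\<zero>\<^bsub>monoid_ring R M\<^esub> = (\<lambda>m. \<zero>)"
  "f \<oplus>\<^bsub>monoid_ring R M\<^esub> g = (\<lambda>m. f m \<oplus> g m)"
  "c \<odot>\<^bsub>monoid_ring R M\<^esub> f = (\<lambda>m. c \<otimes> f m)"
  by (simp_all add: monoid_ring_def)

lemma monoid_ring_mult:
  assumes "f \<in> carrier (monoid_ring R M)" "g \<in> carrier (monoid_ring R M)"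
    and "finite A" "finite B" "{m. f m \<noteq> \<zero>} \<subseteq> A" "{m. g m \<noteq> \<zero>} \<subseteq> B"
  shows "(f \<otimes>\<^bsub>monoid_ring R M\<^esub> g) m =
    (\<Oplus>a\<in>A. \<Oplus>b\<in>B. if a \<otimes>\<^bsub>M\<^esub> b = m then f a \<otimes> g b else \<zero>)"
proof -
  have c: "f m \<in> carrier R" "g m \<in> carrier R" for m
    using assms(1,2) by (auto simp: monoid_ring_carrier)
  let ?h = "\<lambda>a b. if a \<otimes>\<^bsub>M\<^esub> b = m then f a \<otimes> g b else \<zero>"
  have "(f \<otimes>\<^bsub>monoid_ring R M\<^esub> g) m =
      (\<Oplus>p\<in>{(a, b). f a \<noteq> \<zero> \<and> g b \<noteq> \<zero> \<and> a \<otimes>\<^bsub>M\<^esub> b = m}. f (fst p) \<otimes> g (snd p))"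
    by (simp add: monoid_ring_def)
  also have "\<dots> = (\<Oplus>p\<in>A \<times> B. ?h (fst p) (snd p))"
    using assms(3-6) c
    by (intro add.finprod_mono_neutral_cong_left) (auto split: if_splits)
  also have "\<dots> = (\<Oplus>a\<in>A. \<Oplus>b\<in>B. ?h a b)"
    using assms(3,4) c by (intro finsum_times) auto
  finally show ?thesis .
qed

lemma monoid_ring_mult_support:
  assumes "f \<in> carrier (monoid_ring R M)" "g \<in> carrier (monoid_ring R M)"
  shows "{m. (f \<otimes>\<^bsub>monoid_ring R M\<^esub> g) m \<noteq> \<zero>} \<subseteq>
    (\<lambda>(a, b). a \<otimes>\<^bsub>M\<^esub> b) ` ({m. f m \<noteq> \<zero>} \<times> {m. g m \<noteq> \<zero>})"
proof -
  have "(f \<otimes>\<^bsub>monoid_ring R M\<^esub> g) m = \<zero>"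
    if "m \<notin> (\<lambda>(a, b). a \<otimes>\<^bsub>M\<^esub> b) ` ({m. f m \<noteq> \<zero>} \<times> {m. g m \<noteq> \<zero>})" for m
  proof -
    have "(f \<otimes>\<^bsub>monoid_ring R M\<^esub> g) m =
        (\<Oplus>p\<in>{(a, b). f a \<noteq> \<zero> \<and> g b \<noteq> \<zero> \<and> a \<otimes>\<^bsub>M\<^esub> b = m}. f (fst p) \<otimes> g (snd p))"
      by (simp add: monoid_ring_def)
    also have "{(a, b). f a \<noteq> \<zero> \<and> g b \<noteq> \<zero> \<and> a \<otimes>\<^bsub>M\<^esub> b = m} = {}"
      using that by force
    finally show ?thesis by simp
  qed
  then show ?thesis by blast
qed

lemma monoid_ring_mult_closed:
  assumes "comm_monoid M" "f \<in> carrier (monoid_ring R M)" "g \<in> carrier (monoid_ring R M)"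
  shows "f \<otimes>\<^bsub>monoid_ring R M\<^esub> g \<in> carrier (monoid_ring R M)"
proof -
  interpret M: comm_monoid M by fact
  have fin: "finite {m. f m \<noteq> \<zero>}" "finite {m. g m \<noteq> \<zero>}"
    and sub: "{m. f m \<noteq> \<zero>} \<subseteq> carrier M" "{m. g m \<noteq> \<zero>} \<subseteq> carrier M"
    and c: "\<And>m. f m \<in> carrier R" "\<And>m. g m \<in> carrier R"
    using assms(2,3) by (auto simp: monoid_ring_carrier)
  have "(f \<otimes>\<^bsub>monoid_ring R M\<^esub> g) m \<in> carrier R" for m
    unfolding monoid_ring_mult[OF assms(2,3) fin subset_refl subset_refl]
    using c by (intro finsum_closed) (auto intro!: finsum_closed)
  moreover have "finite {m. (f \<otimes>\<^bsub>monoid_ring R M\<^esub> g) m \<noteq> \<zero>}"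
    by (rule finite_subset[OF monoid_ring_mult_support[OF assms(2,3)]]) (use fin in simp)
  moreover have "{m. (f \<otimes>\<^bsub>monoid_ring R M\<^esub> g) m \<noteq> \<zero>} \<subseteq> carrier M"
    using monoid_ring_mult_support[OF assms(2,3)] sub by (fastforce intro: M.m_closed)
  ultimately show ?thesis by (simp add: monoid_ring_carrier)
qed

lemma monoid_ring_mult_comm:
  assumes "comm_monoid M" "f \<in> carrier (monoid_ring R M)" "g \<in> carrier (monoid_ring R M)"
  shows "f \<otimes>\<^bsub>monoid_ring R M\<^esub> g = g \<otimes>\<^bsub>monoid_ring R M\<^esub> f"
proof
  interpret M: comm_monoid M by fact
  fix m
  let ?A = "{m. f m \<noteq> \<zero>}" and ?B = "{m. g m \<noteq> \<zero>}"
  have fin: "finite ?A" "finite ?B"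
    and sub: "?A \<subseteq> carrier M" "?B \<subseteq> carrier M"
    and c: "\<And>m. f m \<in> carrier R" "\<And>m. g m \<in> carrier R"
    using assms(2,3) by (auto simp: monoid_ring_carrier)
  have "(f \<otimes>\<^bsub>monoid_ring R M\<^esub> g) m = (\<Oplus>a\<in>?A. \<Oplus>b\<in>?B. if a \<otimes>\<^bsub>M\<^esub> b = m then f a \<otimes> g b else \<zero>)"
    by (rule monoid_ring_mult[OF assms(2,3) fin subset_refl subset_refl])
  also have "\<dots> = (\<Oplus>b\<in>?B. \<Oplus>a\<in>?A. if a \<otimes>\<^bsub>M\<^esub> b = m then f a \<otimes> g b else \<zero>)"
    using c by (intro finsum_swap fin) auto
  also have "\<dots> = (\<Oplus>b\<in>?B. \<Oplus>a\<in>?A. if b \<otimes>\<^bsub>M\<^esub> a = m then g b \<otimes> f a else \<zero>)"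
  proof (intro finsum_cong' HOL.refl)
    fix b a assume "b \<in> ?B" "a \<in> ?A"
    then have "a \<otimes>\<^bsub>M\<^esub> b = b \<otimes>\<^bsub>M\<^esub> a" using sub by (auto intro: M.m_comm)
    moreover have "f a \<otimes> g b = g b \<otimes> f a" using c by (simp add: m_comm)
    ultimately show "(if a \<otimes>\<^bsub>M\<^esub> b = m then f a \<otimes> g b else \<zero>) =
      (if b \<otimes>\<^bsub>M\<^esub> a = m then g b \<otimes> f a else \<zero>)" by simp
  qed (use c in \<open>auto intro!: finsum_closed\<close>)
  also have "\<dots> = (g \<otimes>\<^bsub>monoid_ring R M\<^esub> f) m"
    by (rule monoid_ring_mult[OF assms(3,2) fin(2,1) subset_refl subset_refl, symmetric])
  finally show "(f \<otimes>\<^bsub>monoid_ring R M\<^esub> g) m = (g \<otimes>\<^bsub>monoid_ring R M\<^esub> f) m" .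
qed

lemma monoid_ring_mult_triple:
  assumes "comm_monoid M" "f \<in> carrier (monoid_ring R M)" "g \<in> carrier (monoid_ring R M)"
    "h \<in> carrier (monoid_ring R M)"
  shows "((f \<otimes>\<^bsub>monoid_ring R M\<^esub> g) \<otimes>\<^bsub>monoid_ring R M\<^esub> h) m =
    (\<Oplus>a\<in>{m. f m \<noteq> \<zero>}. \<Oplus>b\<in>{m. g m \<noteq> \<zero>}. \<Oplus>c\<in>{m. h m \<noteq> \<zero>}.
       if a \<otimes>\<^bsub>M\<^esub> b \<otimes>\<^bsub>M\<^esub> c = m then f a \<otimes> g b \<otimes> h c else \<zero>)"
proof -
  let ?A = "{m. f m \<noteq> \<zero>}" and ?B = "{m. g m \<noteq> \<zero>}" and ?C = "{m. h m \<noteq> \<zero>}"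
  let ?D = "(\<lambda>(a, b). a \<otimes>\<^bsub>M\<^esub> b) ` (?A \<times> ?B)"
  have fin: "finite ?A" "finite ?B" "finite ?C"
    and c [simp]: "\<And>m. f m \<in> carrier R" "\<And>m. g m \<in> carrier R" "\<And>m. h m \<in> carrier R"
    using assms(2-) by (auto simp: monoid_ring_carrier)
  have finD: "finite ?D" using fin by simp
  let ?t = "\<lambda>a b d c. if a \<otimes>\<^bsub>M\<^esub> b = d then (if d \<otimes>\<^bsub>M\<^esub> c = m then f a \<otimes> g b \<otimes> h c else \<zero>) else \<zero>"
  have inner: "(if d \<otimes>\<^bsub>M\<^esub> c = m then (f \<otimes>\<^bsub>monoid_ring R M\<^esub> g) d \<otimes> h c else \<zero>) =
      (\<Oplus>a\<in>?A. \<Oplus>b\<in>?B. ?t a b d c)" for d c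
  proof (cases "d \<otimes>\<^bsub>M\<^esub> c = m")
    case True
    have "(\<Oplus>a\<in>?A. \<Oplus>b\<in>?B. if a \<otimes>\<^bsub>M\<^esub> b = d then f a \<otimes> g b else \<zero>) \<otimes> h c =
        (\<Oplus>a\<in>?A. (\<Oplus>b\<in>?B. if a \<otimes>\<^bsub>M\<^esub> b = d then f a \<otimes> g b else \<zero>) \<otimes> h c)"
      by (intro finsum_ldistr fin) (auto intro!: finsum_closed)
    also have "\<dots> = (\<Oplus>a\<in>?A. \<Oplus>b\<in>?B. (if a \<otimes>\<^bsub>M\<^esub> b = d then f a \<otimes> g b else \<zero>) \<otimes> h c)"
      by (intro finsum_cong' HOL.refl finsum_ldistr fin) (auto intro!: finsum_closed)
    also have "\<dots> = (\<Oplus>a\<in>?A. \<Oplus>b\<in>?B. ?t a b d c)"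
      using True by (intro finsum_cong' HOL.refl) (auto intro!: finsum_closed)
    finally show ?thesis
      using True monoid_ring_mult[OF assms(2,3) fin(1,2) subset_refl subset_refl] by simp
  next
    case False
    then show ?thesis by (simp cong: if_cong add: finsum_zero)
  qed
  have "((f \<otimes>\<^bsub>monoid_ring R M\<^esub> g) \<otimes>\<^bsub>monoid_ring R M\<^esub> h) m =
      (\<Oplus>d\<in>?D. \<Oplus>c\<in>?C. if d \<otimes>\<^bsub>M\<^esub> c = m then (f \<otimes>\<^bsub>monoid_ring R M\<^esub> g) d \<otimes> h c else \<zero>)"
    by (rule monoid_ring_mult[OF monoid_ring_mult_closed[OF assms(1-3)] assms(4) finD fin(3)
          monoid_ring_mult_support[OF assms(2,3)] subset_refl])
  also have "\<dots> = (\<Oplus>d\<in>?D. \<Oplus>c\<in>?C. \<Oplus>a\<in>?A. \<Oplus>b\<in>?B. ?t a b d c)"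
    unfolding inner ..
  also have "\<dots> = (\<Oplus>d\<in>?D. \<Oplus>a\<in>?A. \<Oplus>c\<in>?C. \<Oplus>b\<in>?B. ?t a b d c)"
    by (intro finsum_cong' HOL.refl finsum_swap fin) (auto intro!: finsum_closed)
  also have "\<dots> = (\<Oplus>d\<in>?D. \<Oplus>a\<in>?A. \<Oplus>b\<in>?B. \<Oplus>c\<in>?C. ?t a b d c)"
    by (intro finsum_cong' HOL.refl finsum_swap fin) (auto intro!: finsum_closed)
  also have "\<dots> = (\<Oplus>a\<in>?A. \<Oplus>d\<in>?D. \<Oplus>b\<in>?B. \<Oplus>c\<in>?C. ?t a b d c)"
    by (intro finsum_swap fin finD) (auto intro!: finsum_closed)
  also have "\<dots> = (\<Oplus>a\<in>?A. \<Oplus>b\<in>?B. \<Oplus>d\<in>?D. \<Oplus>c\<in>?C. ?t a b d c)"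
    by (intro finsum_cong' HOL.refl finsum_swap fin finD) (auto intro!: finsum_closed)
  also have "\<dots> = (\<Oplus>a\<in>?A. \<Oplus>b\<in>?B. \<Oplus>c\<in>?C. \<Oplus>d\<in>?D. ?t a b d c)"
    by (intro finsum_cong' HOL.refl finsum_swap fin finD) (auto intro!: finsum_closed)
  also have "\<dots> = (\<Oplus>a\<in>?A. \<Oplus>b\<in>?B. \<Oplus>c\<in>?C.
      if a \<otimes>\<^bsub>M\<^esub> b \<otimes>\<^bsub>M\<^esub> c = m then f a \<otimes> g b \<otimes> h c else \<zero>)"
  proof (intro finsum_cong' HOL.refl)
    fix a b c assume ab: "a \<in> ?A" "b \<in> ?B"
    let ?v = "if a \<otimes>\<^bsub>M\<^esub> b \<otimes>\<^bsub>M\<^esub> c = m then f a \<otimes> g b \<otimes> h c else \<zero>"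
    have "(\<Oplus>d\<in>?D. ?t a b d c) = (\<Oplus>d\<in>?D. if a \<otimes>\<^bsub>M\<^esub> b = d then ?v else \<zero>)"
      by (intro finsum_cong' HOL.refl) auto
    also have "\<dots> = ?v"
      by (rule finsum_delta[OF finD]) (use ab in auto)
    finally show "(\<Oplus>d\<in>?D. ?t a b d c) = ?v" .
  qed (auto intro!: finsum_closed)
  finally show ?thesis .
qed

lemma monoid_ring_mult_assoc:
  assumes "comm_monoid M" "f \<in> carrier (monoid_ring R M)" "g \<in> carrier (monoid_ring R M)"
    "h \<in> carrier (monoid_ring R M)"
  shows "(f \<otimes>\<^bsub>monoid_ring R M\<^esub> g) \<otimes>\<^bsub>monoid_ring R M\<^esub> h =
    f \<otimes>\<^bsub>monoid_ring R M\<^esub> (g \<otimes>\<^bsub>monoid_ring R M\<^esub> h)"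
proof
  interpret M: comm_monoid M by fact
  fix m
  let ?A = "{m. f m \<noteq> \<zero>}" and ?B = "{m. g m \<noteq> \<zero>}" and ?C = "{m. h m \<noteq> \<zero>}"
  have fin: "finite ?A" "finite ?B" "finite ?C"
    and c [simp]: "\<And>m. f m \<in> carrier R" "\<And>m. g m \<in> carrier R" "\<And>m. h m \<in> carrier R"
    and sub: "?A \<subseteq> carrier M" "?B \<subseteq> carrier M" "?C \<subseteq> carrier M"
    using assms(2-) by (auto simp: monoid_ring_carrier)
  let ?t = "\<lambda>a b c. if a \<otimes>\<^bsub>M\<^esub> b \<otimes>\<^bsub>M\<^esub> c = m then f a \<otimes> g b \<otimes> h c else \<zero>"
  let ?s = "\<lambda>a b c. if b \<otimes>\<^bsub>M\<^esub> c \<otimes>\<^bsub>M\<^esub> a = m then g b \<otimes> h c \<otimes> f a else \<zero>"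
  have ts: "?s a b c = ?t a b c" if "a \<in> ?A" "b \<in> ?B" "c \<in> ?C" for a b c
  proof -
    have "a \<in> carrier M" "b \<in> carrier M" "c \<in> carrier M" using that sub by auto
    then have "b \<otimes>\<^bsub>M\<^esub> c \<otimes>\<^bsub>M\<^esub> a = a \<otimes>\<^bsub>M\<^esub> b \<otimes>\<^bsub>M\<^esub> c" by (simp add: M.m_ac)
    moreover have "g b \<otimes> h c \<otimes> f a = f a \<otimes> g b \<otimes> h c" by (simp add: m_ac)
    ultimately show ?thesis by simp
  qed
  have "(f \<otimes>\<^bsub>monoid_ring R M\<^esub> (g \<otimes>\<^bsub>monoid_ring R M\<^esub> h)) m =
      ((g \<otimes>\<^bsub>monoid_ring R M\<^esub> h) \<otimes>\<^bsub>monoid_ring R M\<^esub> f) m"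
    using monoid_ring_mult_comm monoid_ring_mult_closed assms by metis
  also have "\<dots> = (\<Oplus>b\<in>?B. \<Oplus>c\<in>?C. \<Oplus>a\<in>?A. ?s a b c)"
    by (rule monoid_ring_mult_triple[OF assms(1,3,4,2)])
  also have "\<dots> = (\<Oplus>b\<in>?B. \<Oplus>a\<in>?A. \<Oplus>c\<in>?C. ?s a b c)"
    by (intro finsum_cong' HOL.refl finsum_swap fin) (auto intro!: finsum_closed)
  also have "\<dots> = (\<Oplus>a\<in>?A. \<Oplus>b\<in>?B. \<Oplus>c\<in>?C. ?s a b c)"
    by (intro finsum_swap fin) (auto intro!: finsum_closed)
  also have "\<dots> = (\<Oplus>a\<in>?A. \<Oplus>b\<in>?B. \<Oplus>c\<in>?C. ?t a b c)"
    by (intro finsum_cong' HOL.refl ts) (auto intro!: finsum_closed)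
  also have "\<dots> = ((f \<otimes>\<^bsub>monoid_ring R M\<^esub> g) \<otimes>\<^bsub>monoid_ring R M\<^esub> h) m"
    by (rule monoid_ring_mult_triple[OF assms, symmetric])
  finally show "((f \<otimes>\<^bsub>monoid_ring R M\<^esub> g) \<otimes>\<^bsub>monoid_ring R M\<^esub> h) m =
    (f \<otimes>\<^bsub>monoid_ring R M\<^esub> (g \<otimes>\<^bsub>monoid_ring R M\<^esub> h)) m" by simp
qed

lemma basis_element_carrier:
  "m \<in> carrier M \<Longrightarrow> basis_element R m \<in> carrier (monoid_ring R M)"
  by (auto simp: monoid_ring_carrier basis_element_def)

lemma monoid_ring_l_one:
  assumes "comm_monoid M" "f \<in> carrier (monoid_ring R M)"
  shows "\<one>\<^bsub>monoid_ring R M\<^esub> \<otimes>\<^bsub>monoid_ring R M\<^esub> f = f"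
proof
  interpret M: comm_monoid M by fact
  fix m
  let ?A = "{m. f m \<noteq> \<zero>}"
  have fin: "finite ?A" and c [simp]: "\<And>m. f m \<in> carrier R" and sub: "?A \<subseteq> carrier M"
    using assms(2) by (auto simp: monoid_ring_carrier)
  have one: "\<one>\<^bsub>monoid_ring R M\<^esub> \<in> carrier (monoid_ring R M)"
    using basis_element_carrier[OF M.one_closed] by (simp add: basis_element_def)
  have "(\<one>\<^bsub>monoid_ring R M\<^esub> \<otimes>\<^bsub>monoid_ring R M\<^esub> f) m =
    (\<Oplus>a\<in>{\<one>\<^bsub>M\<^esub>}. \<Oplus>b\<in>insert m ?A. if a \<otimes>\<^bsub>M\<^esub> b = m then \<one>\<^bsub>monoid_ring R M\<^esub> a \<otimes> f b else \<zero>)"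
    by (rule monoid_ring_mult[OF one assms(2)]) (use fin in auto)
  also have "\<dots> = (\<Oplus>b\<in>insert m ?A. if \<one>\<^bsub>M\<^esub> \<otimes>\<^bsub>M\<^esub> b = m then f b else \<zero>)"
    by (simp cong: if_cong add: finsum_closed)
  also have "\<dots> = (\<Oplus>b\<in>insert m ?A. if m = b then f m else \<zero>)"
  proof (rule finsum_cong'[OF HOL.refl])
    fix b assume b: "b \<in> insert m ?A"
    show "(if \<one>\<^bsub>M\<^esub> \<otimes>\<^bsub>M\<^esub> b = m then f b else \<zero>) = (if m = b then f m else \<zero>)"
    proof (cases "b \<in> carrier M")
      case False
      then have "f b = \<zero>" "b = m" using b sub by auto
      then show ?thesis by simp
    qed auto
  qed auto
  also have "\<dots> = f m" by (rule finsum_delta) (use fin in auto)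
  finally show "(\<one>\<^bsub>monoid_ring R M\<^esub> \<otimes>\<^bsub>monoid_ring R M\<^esub> f) m = f m" .
qed

lemma monoid_ring_add_closed:
  assumes "f \<in> carrier (monoid_ring R M)" "g \<in> carrier (monoid_ring R M)"
  shows "(\<lambda>m. f m \<oplus> g m) \<in> carrier (monoid_ring R M)"
proof -
  have "{m. f m \<oplus> g m \<noteq> \<zero>} \<subseteq> {m. f m \<noteq> \<zero>} \<union> {m. g m \<noteq> \<zero>}" by auto
  moreover have "finite ({m. f m \<noteq> \<zero>} \<union> {m. g m \<noteq> \<zero>})"
    using assms by (auto simp: monoid_ring_carrier)
  ultimately have "finite {m. f m \<oplus> g m \<noteq> \<zero>}" by (rule finite_subset)
  moreover have "{m. f m \<oplus> g m \<noteq> \<zero>} \<subseteq> carrier M"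
    using \<open>{m. f m \<oplus> g m \<noteq> \<zero>} \<subseteq> _\<close> assms unfolding monoid_ring_carrier by blast
  ultimately show ?thesis using assms by (auto simp: monoid_ring_carrier)
qed

lemma monoid_ring_l_distr:
  assumes "comm_monoid M" "f \<in> carrier (monoid_ring R M)" "g \<in> carrier (monoid_ring R M)"
    "h \<in> carrier (monoid_ring R M)"
  shows "(\<lambda>m. f m \<oplus> g m) \<otimes>\<^bsub>monoid_ring R M\<^esub> h =
    (\<lambda>m. (f \<otimes>\<^bsub>monoid_ring R M\<^esub> h) m \<oplus> (g \<otimes>\<^bsub>monoid_ring R M\<^esub> h) m)"
proof
  fix m
  let ?A = "{m. f m \<noteq> \<zero>} \<union> {m. g m \<noteq> \<zero>}" and ?C = "{m. h m \<noteq> \<zero>}"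
  have fin: "finite ?A" "finite ?C"
    and c [simp]: "\<And>m. f m \<in> carrier R" "\<And>m. g m \<in> carrier R" "\<And>m. h m \<in> carrier R"
    using assms(2-) by (auto simp: monoid_ring_carrier)
  have "((\<lambda>m. f m \<oplus> g m) \<otimes>\<^bsub>monoid_ring R M\<^esub> h) m =
      (\<Oplus>a\<in>?A. \<Oplus>b\<in>?C. if a \<otimes>\<^bsub>M\<^esub> b = m then (f a \<oplus> g a) \<otimes> h b else \<zero>)"
    by (rule monoid_ring_mult[OF monoid_ring_add_closed[OF assms(2,3)] assms(4) fin]) auto
  also have "\<dots> = (\<Oplus>a\<in>?A. \<Oplus>b\<in>?C. (if a \<otimes>\<^bsub>M\<^esub> b = m then f a \<otimes> h b else \<zero>) \<oplus>
      (if a \<otimes>\<^bsub>M\<^esub> b = m then g a \<otimes> h b else \<zero>))"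
    by (intro finsum_cong' HOL.refl) (auto intro!: finsum_closed simp: l_distr)
  also have "\<dots> = (\<Oplus>a\<in>?A. (\<Oplus>b\<in>?C. if a \<otimes>\<^bsub>M\<^esub> b = m then f a \<otimes> h b else \<zero>) \<oplus>
      (\<Oplus>b\<in>?C. if a \<otimes>\<^bsub>M\<^esub> b = m then g a \<otimes> h b else \<zero>))"
    by (intro finsum_cong' HOL.refl finsum_addf) (auto intro!: finsum_closed)
  also have "\<dots> = (\<Oplus>a\<in>?A. \<Oplus>b\<in>?C. if a \<otimes>\<^bsub>M\<^esub> b = m then f a \<otimes> h b else \<zero>) \<oplus>
      (\<Oplus>a\<in>?A. \<Oplus>b\<in>?C. if a \<otimes>\<^bsub>M\<^esub> b = m then g a \<otimes> h b else \<zero>)"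
    by (intro finsum_addf) (auto intro!: finsum_closed)
  also have "\<dots> = (f \<otimes>\<^bsub>monoid_ring R M\<^esub> h) m \<oplus> (g \<otimes>\<^bsub>monoid_ring R M\<^esub> h) m"
    by (subst (1 2) monoid_ring_mult[OF _ assms(4) fin]) (use assms in auto)
  finally show "((\<lambda>m. f m \<oplus> g m) \<otimes>\<^bsub>monoid_ring R M\<^esub> h) m =
    (f \<otimes>\<^bsub>monoid_ring R M\<^esub> h) m \<oplus> (g \<otimes>\<^bsub>monoid_ring R M\<^esub> h) m" .
qed

theorem cring_monoid_ring:
  assumes "comm_monoid M"
  shows "cring (monoid_ring R M)"
proof (rule cringI)
  interpret M: comm_monoid M by fact
  show "abelian_group (monoid_ring R M)"
  proof (rule abelian_groupI)
    fix f assume f: "f \<in> carrier (monoid_ring R M)"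
    have "{m. \<ominus> f m \<noteq> \<zero>} \<subseteq> {m. f m \<noteq> \<zero>}" by auto
    then have "finite {m. \<ominus> f m \<noteq> \<zero>}" "{m. \<ominus> f m \<noteq> \<zero>} \<subseteq> carrier M"
      using f finite_subset by (auto simp: monoid_ring_carrier)
    then have "(\<lambda>m. \<ominus> f m) \<in> carrier (monoid_ring R M)"
      using f by (simp add: monoid_ring_carrier)
    then show "\<exists>g\<in>carrier (monoid_ring R M). g \<oplus>\<^bsub>monoid_ring R M\<^esub> f = \<zero>\<^bsub>monoid_ring R M\<^esub>"
      by (rule bexI[rotated]) (use f in \<open>auto simp: monoid_ring_carrier l_neg\<close>)
    show "f \<oplus>\<^bsub>monoid_ring R M\<^esub> g \<in> carrier (monoid_ring R M)" if "g \<in> carrier (monoid_ring R M)" for g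
      using f that by (simp add: monoid_ring_add_closed)
  qed (auto simp: monoid_ring_carrier a_ac)
  show "comm_monoid (monoid_ring R M)"
  proof (rule comm_monoidI)
    show "\<one>\<^bsub>monoid_ring R M\<^esub> \<in> carrier (monoid_ring R M)"
      using basis_element_carrier[OF M.one_closed] by (simp add: basis_element_def)
  qed (use assms monoid_ring_mult_closed monoid_ring_mult_assoc monoid_ring_mult_comm
         monoid_ring_l_one in blast)+
qed (use assms monoid_ring_l_distr in simp)

end


section \<open>The ideals of the stratification and the Zariski topology\<close>

context cring begin

lemma finsum_monoid_ring:
  assumes "comm_monoid M" "finite A" "F \<in> A \<rightarrow> carrier (monoid_ring R M)"
  shows "(\<Oplus>\<^bsub>monoid_ring R M\<^esub>v\<in>A. F v) m = (\<Oplus>v\<in>A. F v m)"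
proof -
  interpret S: cring "monoid_ring R M" using assms(1) by (rule cring_monoid_ring)
  show ?thesis
    using assms(2,3)
  proof (induction A)
    case (insert v A)
    have F: "F x m \<in> carrier R" if "x \<in> insert v A" for x
      using insert.prems that monoid_ring_carrier[of "F x" M] by blast
    have "F v \<in> carrier (monoid_ring R M)" "F \<in> A \<rightarrow> carrier (monoid_ring R M)"
      using insert.prems by auto
    then show ?case using insert F by (simp add: Pi_def)
  qed simp
qed

lemma linear_span_basis:
  assumes "comm_monoid M" "S \<subseteq> carrier M" "\<one> \<noteq> \<zero>"
  shows "linear_span R (monoid_ring R M) (basis_element R ` S) =
    {f \<in> carrier (monoid_ring R M). \<forall>m. f m \<noteq> \<zero> \<longrightarrow> m \<in> S}"
proof (intro equalityI subsetI)
  interpret S: cring "monoid_ring R M" using assms(1) by (rule cring_monoid_ring)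
  have smult: "c \<odot>\<^bsub>monoid_ring R M\<^esub> basis_element R s \<in> carrier (monoid_ring R M)"
    if "c \<in> carrier R" "s \<in> S" for c s
    using that assms(2) by (auto simp: monoid_ring_carrier basis_element_def)
  {
    fix f assume "f \<in> linear_span R (monoid_ring R M) (basis_element R ` S)"
    then obtain A c where A: "finite A" "A \<subseteq> basis_element R ` S" "c \<in> A \<rightarrow> carrier R"
      and f: "f = (\<Oplus>\<^bsub>monoid_ring R M\<^esub>v \<in> A. c v \<odot>\<^bsub>monoid_ring R M\<^esub> v)"
      by (auto simp: linear_span_def)
    have mem: "(\<lambda>v. c v \<odot>\<^bsub>monoid_ring R M\<^esub> v) \<in> A \<rightarrow> carrier (monoid_ring R M)"
    proof
      fix v assume v: "v \<in> A"
      then obtain s where s: "s \<in> S" "v = basis_element R s" using A(2) by blast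
      have "c v \<in> carrier R" using A(3) v by (rule funcset_mem)
      then show "c v \<odot>\<^bsub>monoid_ring R M\<^esub> v \<in> carrier (monoid_ring R M)"
        unfolding s(2) using s(1) by (rule smult)
    qed
    have "f m = \<zero>" if "m \<notin> S" for m
    proof -
      have "f m = (\<Oplus>v\<in>A. c v \<otimes> v m)"
        unfolding f finsum_monoid_ring[OF assms(1) A(1) mem] by simp
      also have "\<dots> = (\<Oplus>v\<in>A. \<zero>)"
      proof (rule finsum_cong'[OF HOL.refl])
        fix v assume v: "v \<in> A"
        then obtain s where s: "s \<in> S" "v = basis_element R s" using A(2) by blast
        have "c v \<in> carrier R" using A(3) v by (rule funcset_mem)
        moreover have "v m = \<zero>" using s that by (auto simp: basis_element_def)
        ultimately show "c v \<otimes> v m = \<zero>" by simp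
      qed simp
      finally show ?thesis by (simp add: finsum_zero)
    qed
    moreover have "f \<in> carrier (monoid_ring R M)" unfolding f using mem by (rule S.finsum_closed)
    ultimately show "f \<in> {f \<in> carrier (monoid_ring R M). \<forall>m. f m \<noteq> \<zero> \<longrightarrow> m \<in> S}" by blast
  next
    fix f assume f: "f \<in> {f \<in> carrier (monoid_ring R M). \<forall>m. f m \<noteq> \<zero> \<longrightarrow> m \<in> S}"
    let ?T = "{m. f m \<noteq> \<zero>}"
    have T: "finite ?T" "?T \<subseteq> S" and c: "f m \<in> carrier R" for m
      using f by (auto simp: monoid_ring_carrier)
    have inj: "inj_on (basis_element R) ?T"
    proof (rule inj_onI)
      fix a b assume "basis_element R a = basis_element R b"
      then have "basis_element R a a = basis_element R b a" by simp
      then show "a = b" using assms(3) by (simp add: basis_element_def split: if_splits)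
    qed
    let ?c = "\<lambda>v. f (inv_into ?T (basis_element R) v)"
    have mem: "(\<lambda>v. ?c v \<odot>\<^bsub>monoid_ring R M\<^esub> v) \<in> basis_element R ` ?T \<rightarrow> carrier (monoid_ring R M)"
      using smult[OF c] T(2) by (blast intro: Pi_I)
    have "f m = (\<Oplus>\<^bsub>monoid_ring R M\<^esub>v \<in> basis_element R ` ?T. ?c v \<odot>\<^bsub>monoid_ring R M\<^esub> v) m" for m
    proof -
      have "(\<Oplus>\<^bsub>monoid_ring R M\<^esub>v \<in> basis_element R ` ?T. ?c v \<odot>\<^bsub>monoid_ring R M\<^esub> v) m =
          (\<Oplus>v\<in>basis_element R ` ?T. ?c v \<otimes> v m)"
        using finsum_monoid_ring[OF assms(1) _ mem, of m] T(1) by simp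
      also have "\<dots> = (\<Oplus>s\<in>?T. ?c (basis_element R s) \<otimes> basis_element R s m)"
      proof (rule finsum_reindex[OF _ inj], rule Pi_I)
        fix v assume "v \<in> basis_element R ` ?T"
        then obtain s where "v = basis_element R s" by blast
        then have "v m \<in> carrier R" by (simp add: basis_element_def)
        then show "?c v \<otimes> v m \<in> carrier R" using c by simp
      qed
      also have "\<dots> = (\<Oplus>s\<in>?T. if m = s then f m else \<zero>)"
      proof (rule finsum_cong'[OF HOL.refl])
        fix s assume "s \<in> ?T"
        then have "?c (basis_element R s) = f s" by (simp add: inv_into_f_f[OF inj])
        then show "?c (basis_element R s) \<otimes> basis_element R s m = (if m = s then f m else \<zero>)"
          using c by (simp add: basis_element_def)
      qed (use c in simp)
      also have "\<dots> = f m"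
      proof (cases "m \<in> ?T")
        case True
        then show ?thesis using T(1) c by (intro finsum_delta) auto
      next
        case False
        then have "(\<Oplus>s\<in>?T. if m = s then f m else \<zero>) = (\<Oplus>s\<in>?T. \<zero>)"
          by (intro finsum_cong') auto
        then show ?thesis using False by (simp add: finsum_zero)
      qed
      finally show ?thesis by simp
    qed
    then have "f = (\<Oplus>\<^bsub>monoid_ring R M\<^esub>v \<in> basis_element R ` ?T. ?c v \<odot>\<^bsub>monoid_ring R M\<^esub> v)"
      by (rule ext)
    moreover have "finite (basis_element R ` ?T)" using T(1) by (rule finite_imageI)
    moreover have "basis_element R ` ?T \<subseteq> basis_element R ` S" using T(2) by (rule image_mono)
    moreover have "?c \<in> basis_element R ` ?T \<rightarrow> carrier R" using c by (rule Pi_I)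
    ultimately show "f \<in> linear_span R (monoid_ring R M) (basis_element R ` S)"
      unfolding linear_span_def by (intro CollectI exI conjI)
  }
qed

lemma ideal_linear_span_basis:
  assumes "comm_monoid M" "S \<subseteq> carrier M" "\<one> \<noteq> \<zero>"
    and S: "\<And>s m. s \<in> S \<Longrightarrow> m \<in> carrier M \<Longrightarrow> m \<otimes>\<^bsub>M\<^esub> s \<in> S"
  shows "ideal (linear_span R (monoid_ring R M) (basis_element R ` S)) (monoid_ring R M)"
proof -
  interpret S: cring "monoid_ring R M" using assms(1) by (rule cring_monoid_ring)
  let ?I = "{f \<in> carrier (monoid_ring R M). \<forall>m. f m \<noteq> \<zero> \<longrightarrow> m \<in> S}"
  have closed: "g \<otimes>\<^bsub>monoid_ring R M\<^esub> f \<in> ?I" if f: "f \<in> ?I" and g: "g \<in> carrier (monoid_ring R M)" for f g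
  proof -
    have gM: "{m. g m \<noteq> \<zero>} \<subseteq> carrier M" using g by (simp add: monoid_ring_carrier)
    have "{m. (g \<otimes>\<^bsub>monoid_ring R M\<^esub> f) m \<noteq> \<zero>} \<subseteq> S"
    proof (rule order_trans[OF monoid_ring_mult_support[OF g]])
      show "f \<in> carrier (monoid_ring R M)" using f by simp
      show "(\<lambda>(a, b). a \<otimes>\<^bsub>M\<^esub> b) ` ({m. g m \<noteq> \<zero>} \<times> {m. f m \<noteq> \<zero>}) \<subseteq> S"
      proof clarify
        fix a b assume "g a \<noteq> \<zero>" "f b \<noteq> \<zero>"
        then have "a \<in> carrier M" "b \<in> S" using gM f by blast+
        then show "a \<otimes>\<^bsub>M\<^esub> b \<in> S" by (intro S)
      qed
    qed
    moreover have "g \<otimes>\<^bsub>monoid_ring R M\<^esub> f \<in> carrier (monoid_ring R M)"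
      using f g by (intro S.m_closed) simp_all
    ultimately show ?thesis by blast
  qed
  have "ideal ?I (monoid_ring R M)"
  proof (rule idealI)
    show "ring (monoid_ring R M)" by (rule S.ring_axioms)
    show "subgroup ?I (add_monoid (monoid_ring R M))"
    proof (rule S.add.subgroupI)
      have "\<zero>\<^bsub>monoid_ring R M\<^esub> \<in> ?I" using S.zero_closed by simp
      then show "?I \<noteq> {}" by blast
      fix f assume f: "f \<in> ?I"
      have m: "\<ominus>\<^bsub>monoid_ring R M\<^esub> \<one>\<^bsub>monoid_ring R M\<^esub> \<otimes>\<^bsub>monoid_ring R M\<^esub> f = \<ominus>\<^bsub>monoid_ring R M\<^esub> f"
      proof -
        have fc: "f \<in> carrier (monoid_ring R M)" using f by simp
        show ?thesis unfolding S.l_minus[OF S.one_closed fc] S.l_one[OF fc] ..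
      qed
      show "\<ominus>\<^bsub>monoid_ring R M\<^esub> f \<in> ?I"
        by (subst m[symmetric], rule closed[OF f]) (intro S.a_inv_closed S.one_closed)
      show "\<And>g. g \<in> ?I \<Longrightarrow> f \<oplus>\<^bsub>monoid_ring R M\<^esub> g \<in> ?I"
      proof -
        fix g assume g: "g \<in> ?I"
        have "m \<in> S" if "f m \<oplus> g m \<noteq> \<zero>" for m
        proof (rule ccontr)
          assume "m \<notin> S"
          then have "f m = \<zero>" "g m = \<zero>" using f g by auto
          then show False using that by simp
        qed
        then show "f \<oplus>\<^bsub>monoid_ring R M\<^esub> g \<in> ?I"
          using f g monoid_ring_add_closed[of f M g] by simp
      qed
    qed auto
    fix f g assume fg: "f \<in> ?I" "g \<in> carrier (monoid_ring R M)"
    show "g \<otimes>\<^bsub>monoid_ring R M\<^esub> f \<in> ?I" by (rule closed[OF fg])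
    have "f \<otimes>\<^bsub>monoid_ring R M\<^esub> g = g \<otimes>\<^bsub>monoid_ring R M\<^esub> f"
      using fg by (intro S.m_comm) simp_all
    then show "f \<otimes>\<^bsub>monoid_ring R M\<^esub> g \<in> ?I" by (rule ssubst) (rule closed[OF fg])
  qed
  then show ?thesis by (simp only: linear_span_basis[OF assms(1-3)])
qed

lemma istopology_zariski: "istopology (\<lambda>U. \<exists>I. ideal I R \<and> U = Spec R - vanishing R I)"
  unfolding istopology_def
proof (intro conjI allI impI)
  fix U V assume "\<exists>I. ideal I R \<and> U = Spec R - vanishing R I" "\<exists>I. ideal I R \<and> V = Spec R - vanishing R I"
  then obtain I J where I: "ideal I R" "U = Spec R - vanishing R I"
    and J: "ideal J R" "V = Spec R - vanishing R J" by blast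
  interpret I: ideal I R by fact
  interpret J: ideal J R by fact
  have "I \<subseteq> P \<or> J \<subseteq> P" if P: "primeideal P R" "I \<inter> J \<subseteq> P" for P
  proof (rule ccontr)
    assume "\<not> (I \<subseteq> P \<or> J \<subseteq> P)"
    then obtain a b where ab: "a \<in> I" "a \<notin> P" "b \<in> J" "b \<notin> P" by blast
    then have "a \<in> carrier R" "b \<in> carrier R" by (auto simp: I.Icarr J.Icarr)
    moreover have "a \<otimes> b \<in> I \<inter> J"
      using ab \<open>a \<in> carrier R\<close> \<open>b \<in> carrier R\<close> I.I_r_closed J.I_l_closed by blast
    ultimately show False using primeideal.I_prime[OF P(1)] P(2) ab by blast
  qed
  then have "U \<inter> V = Spec R - vanishing R (I \<inter> J)"
    unfolding I(2) J(2) by (auto simp: vanishing_def Spec_def)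
  moreover have "ideal (I \<inter> J) R" using I(1) J(1) by (rule i_intersect)
  ultimately show "\<exists>I. ideal I R \<and> U \<inter> V = Spec R - vanishing R I" by blast
next
  fix \<U> assume "\<forall>U\<in>\<U>. \<exists>I. ideal I R \<and> U = Spec R - vanishing R I"
  then obtain F where F: "\<And>U. U \<in> \<U> \<Longrightarrow> ideal (F U) R" "\<And>U. U \<in> \<U> \<Longrightarrow> U = Spec R - vanishing R (F U)"
    by metis
  let ?J = "\<Union>U\<in>\<U>. F U"
  have sub: "?J \<subseteq> carrier R" using F(1) ideal.Icarr by fastforce
  have "(Idl ?J \<subseteq> P) = (\<forall>U\<in>\<U>. F U \<subseteq> P)" if "primeideal P R" for P
    using genideal_self[OF sub] genideal_minimal[of P ?J] primeideal.axioms(1)[OF that] by blast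
  then have "(\<Union>U\<in>\<U>. Spec R - vanishing R (F U)) = Spec R - vanishing R (Idl ?J)"
    by (auto simp: vanishing_def Spec_def)
  moreover have "(\<Union>U\<in>\<U>. Spec R - vanishing R (F U)) = (\<Union>U\<in>\<U>. U)"
    by (intro SUP_cong HOL.refl F(2)[symmetric])
  ultimately have "\<Union>\<U> = Spec R - vanishing R (Idl ?J)" by simp
  then show "\<exists>I. ideal I R \<and> \<Union>\<U> = Spec R - vanishing R I"
    using genideal_ideal[OF sub] by blast
qed

end

lemma (in group) component_group_mult:
  assumes "m \<in> carrier (Comp G D \<xi>)" "m' \<in> carrier (Comp G D \<xi>)"
  shows "component_group G m' \<subseteq> component_group G (m \<otimes>\<^bsub>Comp G D \<xi>\<^esub> m')"
proof -
  obtain x n where x: "x \<in> component_tuples G D \<xi> n" "m = hurwitz_orbit G x"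
    using assms(1) by (auto simp: Comp_carrier)
  obtain y k where y: "y \<in> component_tuples G D \<xi> k" "m' = hurwitz_orbit G y"
    using assms(2) by (auto simp: Comp_carrier)
  note t = component_tuples_in[OF x(1)] component_tuples_in[OF y(1)]
  note u = tuples_append[OF t]
  have "component_group G m' = generate G (set y)"
    unfolding y(2) by (rule component_group_eq[OF t(2) hurwitz_orbit_refl[OF t(2)]])
  moreover have "component_group G (m \<otimes>\<^bsub>Comp G D \<xi>\<^esub> m') = generate G (set (x @ y))"
    unfolding x(2) y(2) Comp_mult[OF t] by (rule component_group_eq[OF u hurwitz_orbit_refl[OF u]])
  ultimately show ?thesis by (simp add: mono_generate)
qed

theorem ideal_ideal_above:
  assumes "group G" "field K"
  shows "ideal (ideal_above G D \<xi> K H) (ring_of_components G D \<xi> K)"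
    and "ideal (ideal_strictly_above G D \<xi> K H) (ring_of_components G D \<xi> K)"
proof -
  interpret G: group G by fact
  interpret K: field K by fact
  note C = G.comm_monoid_Comp[of D \<xi>]
  interpret C: comm_monoid "Comp G D \<xi>" by (rule C)
  have mult: "m \<otimes>\<^bsub>Comp G D \<xi>\<^esub> s \<in> carrier (Comp G D \<xi>)"
    "component_group G s \<subseteq> component_group G (m \<otimes>\<^bsub>Comp G D \<xi>\<^esub> s)"
    if "s \<in> carrier (Comp G D \<xi>)" "m \<in> carrier (Comp G D \<xi>)" for s m
    using that G.component_group_mult C.m_closed by blast+
  show "ideal (ideal_above G D \<xi> K H) (ring_of_components G D \<xi> K)"
    unfolding ideal_above_def ring_of_components_def
    by (rule K.ideal_linear_span_basis[OF C]) (use mult K.one_not_zero in blast)+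
  show "ideal (ideal_strictly_above G D \<xi> K H) (ring_of_components G D \<xi> K)"
    unfolding ideal_strictly_above_def ring_of_components_def
    by (rule K.ideal_linear_span_basis[OF C]) (use mult K.one_not_zero in blast)+
qed

theorem cring_ring_of_components:
  assumes "group G" "field K"
  shows "cring (ring_of_components G D \<xi> K)"
proof -
  interpret G: group G by fact
  interpret K: field K by fact
  show ?thesis
    unfolding ring_of_components_def by (intro K.cring_monoid_ring G.comm_monoid_Comp)
qed

end

(* Let P be a prime ideal. The components outside P form a multiplicative set containing the trivial
   component, and the group of a product contains the groups of both factors. So the groups of the
   components outside P are directed under inclusion, and as G is finite they have a largest element H.
   Membership of P in the stratum of H says precisely that H is this largest group. *)

theory Submission
  imports Defs
begin

context cring begin

text \<open>The convolution of two functions supported at single points has a single term. Taking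
  \<open>c\<close> and \<open>d\<close> to be \<open>\<one>\<close> gives the product of basis
  elements. Taking \<open>a\<close> to be the identity of \<open>M\<close> turns scaling into
  multiplication inside the ring.\<close>

lemma monomial_mult:
  assumes "a \<in> carrier M" "b \<in> carrier M" "c \<in> carrier R" "d \<in> carrier R"
  shows "(c \<odot>\<^bsub>monoid_ring R M\<^esub> basis_element R a) \<otimes>\<^bsub>monoid_ring R M\<^esub>
      (d \<odot>\<^bsub>monoid_ring R M\<^esub> basis_element R b) =
    (c \<otimes> d) \<odot>\<^bsub>monoid_ring R M\<^esub> basis_element R (a \<otimes>\<^bsub>M\<^esub> b)"
proof
  fix m
  have monomial: "e \<odot>\<^bsub>monoid_ring R M\<^esub> basis_element R x \<in> carrier (monoid_ring R M)"
    if "x \<in> carrier M" "e \<in> carrier R" for e x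
    using that by (auto simp: monoid_ring_carrier basis_element_def)
  have "((c \<odot>\<^bsub>monoid_ring R M\<^esub> basis_element R a) \<otimes>\<^bsub>monoid_ring R M\<^esub>
      (d \<odot>\<^bsub>monoid_ring R M\<^esub> basis_element R b)) m =
    (\<Oplus>x\<in>{a}. \<Oplus>y\<in>{b}. if x \<otimes>\<^bsub>M\<^esub> y = m then
      (c \<odot>\<^bsub>monoid_ring R M\<^esub> basis_element R a) x \<otimes> (d \<odot>\<^bsub>monoid_ring R M\<^esub> basis_element R b) y
      else \<zero>)"
    \<comment> \<open>The singletons contain the supports even if \<open>c\<close> or
      \<open>d\<close> is zero, and \<open>monoid_ring_mult\<close> asks for no more.\<close>
    using assms by (intro monoid_ring_mult monomial) (auto simp: basis_element_def)
  also have "\<dots> = ((c \<otimes> d) \<odot>\<^bsub>monoid_ring R M\<^esub> basis_element R (a \<otimes>\<^bsub>M\<^esub> b)) m"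
    using assms by (auto simp: basis_element_def)
  finally show "((c \<odot>\<^bsub>monoid_ring R M\<^esub> basis_element R a) \<otimes>\<^bsub>monoid_ring R M\<^esub>
      (d \<odot>\<^bsub>monoid_ring R M\<^esub> basis_element R b)) m =
    ((c \<otimes> d) \<odot>\<^bsub>monoid_ring R M\<^esub> basis_element R (a \<otimes>\<^bsub>M\<^esub> b)) m" .
qed

lemma smult_one_basis_element:
  "m \<in> carrier M \<Longrightarrow> \<one> \<odot>\<^bsub>monoid_ring R M\<^esub> basis_element R m = basis_element R m"
  by (auto simp: basis_element_def)

lemma basis_element_mult:
  assumes "a \<in> carrier M" "b \<in> carrier M" "a \<otimes>\<^bsub>M\<^esub> b \<in> carrier M"
  shows "basis_element R a \<otimes>\<^bsub>monoid_ring R M\<^esub> basis_element R b = basis_element R (a \<otimes>\<^bsub>M\<^esub> b)"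
  using monomial_mult[OF assms(1,2) one_closed one_closed]
  by (simp only: assms smult_one_basis_element r_one one_closed)

text \<open>An ideal of the monoid ring is also a linear subspace, so it contains a span as soon as
  it contains the spanning set. This reduces the conditions defining a stratum to the question of
  which components lie in a given prime.\<close>

lemma linear_span_basis_subset_ideal_iff:
  assumes "comm_monoid M" "S \<subseteq> carrier M" "\<one> \<noteq> \<zero>" "ideal P (monoid_ring R M)"
  shows "linear_span R (monoid_ring R M) (basis_element R ` S) \<subseteq> P \<longleftrightarrow> basis_element R ` S \<subseteq> P"
proof
  assume "linear_span R (monoid_ring R M) (basis_element R ` S) \<subseteq> P"
  moreover have "basis_element R ` S \<subseteq> linear_span R (monoid_ring R M) (basis_element R ` S)"
  proof clarify
    fix s assume "s \<in> S"
    moreover from this have "basis_element R s \<in> carrier (monoid_ring R M)"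
      using assms(2) by (intro basis_element_carrier) blast
    ultimately show "basis_element R s \<in> linear_span R (monoid_ring R M) (basis_element R ` S)"
      \<comment> \<open>The span consists of the ring elements supported in
        \<open>S\<close>.\<close>
      unfolding linear_span_basis[OF assms(1-3)] by (simp add: basis_element_def)
  qed
  ultimately show "basis_element R ` S \<subseteq> P" by blast
next
  interpret M: comm_monoid M by fact
  interpret P: ideal P "monoid_ring R M" by fact
  assume S: "basis_element R ` S \<subseteq> P"
  have smult: "c \<odot>\<^bsub>monoid_ring R M\<^esub> basis_element R s \<in> P" if "c \<in> carrier R" "s \<in> S" for c s
  proof -
    have s: "s \<in> carrier M" using that assms(2) by blast
    \<comment> \<open>\<open>P\<close> is given as closed under ring multiplication only, so the
      scalar \<open>c\<close> is realised as the ring element \<open>c\<close> times the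
      unit.\<close>
    have "c \<odot>\<^bsub>monoid_ring R M\<^esub> basis_element R \<one>\<^bsub>M\<^esub> \<in> carrier (monoid_ring R M)"
      using that by (auto simp: monoid_ring_carrier basis_element_def)
    then have "(c \<odot>\<^bsub>monoid_ring R M\<^esub> basis_element R \<one>\<^bsub>M\<^esub>) \<otimes>\<^bsub>monoid_ring R M\<^esub> basis_element R s \<in> P"
      using S that(2) by (intro P.I_l_closed) blast+
    then show ?thesis
      using monomial_mult[OF M.one_closed s that(1) one_closed] that(1)
      by (simp only: smult_one_basis_element[OF s] r_one M.l_one[OF s])
  qed
  show "linear_span R (monoid_ring R M) (basis_element R ` S) \<subseteq> P"
  proof
    fix f assume "f \<in> linear_span R (monoid_ring R M) (basis_element R ` S)"
    then obtain A c where A: "finite A" "A \<subseteq> basis_element R ` S" "c \<in> A \<rightarrow> carrier R"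
      and f: "f = (\<Oplus>\<^bsub>monoid_ring R M\<^esub>v\<in>A. c v \<odot>\<^bsub>monoid_ring R M\<^esub> v)"
      unfolding linear_span_def by blast
    have mem: "c v \<odot>\<^bsub>monoid_ring R M\<^esub> v \<in> P" if "v \<in> A" for v
      using smult A(2,3) that by blast
    show "f \<in> P" unfolding f using A(1) mem
    proof (induction A)
      case empty
      show ?case using P.zero_closed by (simp del: monoid_ring_simps)
    next
      case (insert v A)
      then show ?case by (subst P.finsum_insert) (auto simp del: monoid_ring_simps)
    qed
  qed
qed

lemma basis_element_one: "basis_element R \<one>\<^bsub>M\<^esub> = \<one>\<^bsub>monoid_ring R M\<^esub>"
  by (simp add: basis_element_def)

lemma openin_zariski: "openin (zariski R) U \<longleftrightarrow> (\<exists>I. ideal I R \<and> U = Spec R - vanishing R I)"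
  unfolding zariski_def by (simp add: topology_inverse'[OF istopology_zariski])

lemma topspace_zariski: "topspace (zariski R) = Spec R"
proof -
  \<comment> \<open>Prime ideals are proper, so the unit ideal cuts out the empty set and its
    complement, the whole spectrum, is open.\<close>
  have "vanishing R (carrier R) = {}"
    using primeideal.I_notcarr ideal.Icarr primeideal.axioms(1)
    by (fastforce simp: vanishing_def Spec_def)
  then have "openin (zariski R) (Spec R)"
    unfolding openin_zariski using oneideal by (intro exI[of _ "carrier R"]) simp
  moreover have "U \<subseteq> Spec R" if "openin (zariski R) U" for U
    using that unfolding openin_zariski by blast
  ultimately show ?thesis using openin_subset openin_topspace by (metis subset_antisym)
qed

lemma locally_closedin_vanishing_diff:
  assumes "ideal I R" "ideal J R"
  shows "locally_closedin (zariski R) (vanishing R I - vanishing R J)"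
proof -
  have sub: "vanishing R I \<subseteq> Spec R" by (auto simp: vanishing_def)
  have "openin (zariski R) (Spec R - vanishing R J)" unfolding openin_zariski using assms(2) by blast
  moreover have "closedin (zariski R) (vanishing R I)"
    unfolding closedin_def topspace_zariski openin_zariski using sub assms(1) by blast
  moreover have "vanishing R I - vanishing R J = (Spec R - vanishing R J) \<inter> vanishing R I"
    using sub by blast
  ultimately show ?thesis unfolding locally_closedin_def by blast
qed

end

text \<open>Guarantees that the largest group attached to a prime belongs to the index set of the
  stratification.\<close>

lemma (in group) subgroup_component_group:
  assumes "m \<in> carrier (Comp G D \<xi>)"
  shows "subgroup (component_group G m) G"
proof -
  obtain x n where x: "x \<in> component_tuples G D \<xi> n" "m = hurwitz_orbit G x"
    using assms by (auto simp: Comp_carrier)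
  note t = component_tuples_in[OF x(1)]
  have "component_group G m = generate G (set x)"
    unfolding x(2) by (rule component_group_eq[OF t hurwitz_orbit_refl[OF t]])
  then show ?thesis using t by (simp add: generate_is_subgroup tuples_def)
qed

text \<open>For a prime \<open>P\<close> this is the submonoid of components that stay nonzero
  modulo \<open>P\<close>. It is all that the strata detect of \<open>P\<close>.\<close>

definition components_outside ::
    "('g, 'x) monoid_scheme \<Rightarrow> 'g set set \<Rightarrow> ('g set \<Rightarrow> nat) \<Rightarrow> ('k, 'y) ring_scheme \<Rightarrow>
     ('g list set \<Rightarrow> 'k) set \<Rightarrow> 'g list set set" where
  "components_outside G D \<xi> K P = {m \<in> carrier (Comp G D \<xi>). basis_element K m \<notin> P}"

text \<open>\<open>P\<close> contains the ideal strictly above \<open>H\<close> iff no component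
  outside \<open>P\<close> has a group properly containing \<open>H\<close>. \<open>P\<close> fails
  to contain the ideal above \<open>H\<close> iff some component outside \<open>P\<close> has a
  group containing \<open>H\<close>; under the first condition this group must be \<open>H\<close>
  itself. Thus \<open>H\<close> is a maximal element among the groups of the components outside
  \<open>P\<close>.\<close>

lemma stratum_iff:
  assumes "group G" "field K"
  shows "P \<in> stratum G D \<xi> K H \<longleftrightarrow> P \<in> Spec (ring_of_components G D \<xi> K) \<and>
    H \<in> component_group G ` components_outside G D \<xi> K P \<and>
    (\<forall>m\<in>components_outside G D \<xi> K P. \<not> H \<subset> component_group G m)"
proof (cases "P \<in> Spec (ring_of_components G D \<xi> K)")
  case True
  interpret G: group G by fact
  interpret K: field K by fact
  have P: "ideal P (monoid_ring K (Comp G D \<xi>))"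
    using True primeideal.axioms(1) by (auto simp: Spec_def ring_of_components_def)
  have above: "ideal_above G D \<xi> K H \<subseteq> P \<longleftrightarrow>
      (\<forall>m\<in>components_outside G D \<xi> K P. \<not> H \<subseteq> component_group G m)"
    unfolding ideal_above_def ring_of_components_def components_outside_def
    by (subst K.linear_span_basis_subset_ideal_iff[OF G.comm_monoid_Comp _ K.one_not_zero P]) auto
  have "ideal_strictly_above G D \<xi> K H \<subseteq> P \<longleftrightarrow>
      (\<forall>m\<in>components_outside G D \<xi> K P. \<not> H \<subset> component_group G m)"
    unfolding ideal_strictly_above_def ring_of_components_def components_outside_def
    by (subst K.linear_span_basis_subset_ideal_iff[OF G.comm_monoid_Comp _ K.one_not_zero P]) auto
  with above True show ?thesis by (auto simp: stratum_def vanishing_def)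
qed (simp add: stratum_def vanishing_def)

text \<open>The basis element of the trivial component is the unit of the ring, which a proper ideal
  omits. So every prime has at least one group to choose from.\<close>

lemma components_outside_one:
  assumes "group G" "field K" "P \<in> Spec (ring_of_components G D \<xi> K)"
  shows "\<one>\<^bsub>Comp G D \<xi>\<^esub> \<in> components_outside G D \<xi> K P"
proof -
  interpret K: field K by fact
  interpret C: comm_monoid "Comp G D \<xi>" using assms(1) by (rule group.comm_monoid_Comp)
  interpret P: primeideal P "monoid_ring K (Comp G D \<xi>)"
    using assms(3) by (simp add: Spec_def ring_of_components_def)
  show ?thesis
    using P.one_imp_carrier P.I_notcarr K.basis_element_one[of "Comp G D \<xi>"]
    by (auto simp: components_outside_def simp del: K.monoid_ring_simps)
qed

text \<open>Primality of \<open>P\<close>, since the product of two basis elements is the basis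
  element of the product.\<close>

lemma components_outside_mult:
  assumes "group G" "field K" "P \<in> Spec (ring_of_components G D \<xi> K)"
    and "a \<in> components_outside G D \<xi> K P" "b \<in> components_outside G D \<xi> K P"
  shows "a \<otimes>\<^bsub>Comp G D \<xi>\<^esub> b \<in> components_outside G D \<xi> K P"
proof -
  interpret K: field K by fact
  interpret C: comm_monoid "Comp G D \<xi>" using assms(1) by (rule group.comm_monoid_Comp)
  interpret P: primeideal P "monoid_ring K (Comp G D \<xi>)"
    using assms(3) by (simp add: Spec_def ring_of_components_def)
  have ab: "a \<in> carrier (Comp G D \<xi>)" "b \<in> carrier (Comp G D \<xi>)" "basis_element K a \<notin> P" "basis_element K b \<notin> P"
    using assms(4,5) by (auto simp: components_outside_def)
  then have "basis_element K a \<otimes>\<^bsub>monoid_ring K (Comp G D \<xi>)\<^esub> basis_element K b \<notin> P"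
    using P.I_prime[OF ab(1,2)[THEN K.basis_element_carrier]] by blast
  then show ?thesis using ab K.basis_element_mult[OF ab(1,2)] by (simp add: components_outside_def)
qed

theorem theorem1p1:
  fixes G :: "('g, 'x) monoid_scheme"
    and D :: "'g set set"
    and \<xi> :: "'g set \<Rightarrow> nat"
    and K :: "('k, 'y) ring_scheme"
  assumes "group G"
    and "finite (carrier G)"
    and "D \<noteq> {}"
    and "D \<subseteq> conjugacy_classes G - {{\<one>\<^bsub>G\<^esub>}}"
    and "\<forall>\<gamma>\<in>D. \<xi> \<gamma> > 0"
    and "field K"
    and "\<not> ring_characteristic K dvd order G"
  shows "(\<forall>H. subgroup H G \<longrightarrow>
            locally_closedin (zariski (ring_of_components G D \<xi> K)) (stratum G D \<xi> K H)) \<and>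
         Spec (ring_of_components G D \<xi> K) = (\<Union>H\<in>{H. subgroup H G}. stratum G D \<xi> K H) \<and>
         disjoint_family_on (stratum G D \<xi> K) {H. subgroup H G}"
proof (intro conjI allI impI)
  interpret G: group G by fact
  interpret C: comm_monoid "Comp G D \<xi>" by (rule G.comm_monoid_Comp)
  interpret R: cring "ring_of_components G D \<xi> K"
    using assms(1,6) by (rule cring_ring_of_components)
  note iff = stratum_iff[OF assms(1,6)]
  show "locally_closedin (zariski (ring_of_components G D \<xi> K)) (stratum G D \<xi> K H)" for H
    unfolding stratum_def
    by (intro R.locally_closedin_vanishing_diff ideal_ideal_above assms(1,6))
  show "Spec (ring_of_components G D \<xi> K) = (\<Union>H\<in>{H. subgroup H G}. stratum G D \<xi> K H)"
  proof (intro equalityI subsetI)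
    fix P assume P: "P \<in> Spec (ring_of_components G D \<xi> K)"
    let ?\<H> = "component_group G ` components_outside G D \<xi> K P"
    have sub: "subgroup H G" if "H \<in> ?\<H>" for H
      using that G.subgroup_component_group by (auto simp: components_outside_def)
    then have "?\<H> \<subseteq> Pow (carrier G)" using subgroup.subset by blast
    then have "finite ?\<H>" using assms(2) by (meson finite_Pow_iff finite_subset)
    moreover have "?\<H> \<noteq> {}" using components_outside_one[OF assms(1,6) P] by blast
    \<comment> \<open>A maximal element is enough for covering the spectrum; that it is the largest
      one only matters for disjointness.\<close>
    ultimately obtain H where "H \<in> ?\<H>" "\<And>H'. H' \<in> ?\<H> \<Longrightarrow> H \<subseteq> H' \<Longrightarrow> H = H'"
      using finite_has_maximal by metis
    then show "P \<in> (\<Union>H\<in>{H. subgroup H G}. stratum G D \<xi> K H)"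
      using P sub by (intro UN_I[of H]) (auto simp: iff)
  qed (simp add: iff)
  \<comment> \<open>Directedness: if components outside \<open>P\<close> have groups
    \<open>H\<close> and \<open>H'\<close>, their product is outside \<open>P\<close> and its group
    contains both. Maximality of \<open>H\<close> makes that group equal to \<open>H\<close>, so
    \<open>H'\<close> lies in \<open>H\<close>.\<close>
  have le: "H' \<subseteq> H" if H: "P \<in> stratum G D \<xi> K H" and H': "P \<in> stratum G D \<xi> K H'" for P H H'
  proof -
    obtain a b where ab: "a \<in> components_outside G D \<xi> K P" "H = component_group G a"
        "b \<in> components_outside G D \<xi> K P" "H' = component_group G b"
      using H H' by (auto simp: iff)
    have c: "a \<in> carrier (Comp G D \<xi>)" "b \<in> carrier (Comp G D \<xi>)"
      using ab(1,3) by (auto simp: components_outside_def)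
    let ?L = "component_group G (a \<otimes>\<^bsub>Comp G D \<xi>\<^esub> b)"
    have "a \<otimes>\<^bsub>Comp G D \<xi>\<^esub> b \<in> components_outside G D \<xi> K P"
      using components_outside_mult[OF assms(1,6) _ ab(1,3)] H by (simp add: iff)
    then have "\<not> H \<subset> ?L" using H by (simp add: iff)
    \<comment> \<open>\<open>component_group_mult\<close> speaks of the right factor; commutativity
      of the monoid of components transfers it to the left one.\<close>
    moreover have "H' \<subseteq> ?L" "H \<subseteq> ?L"
      unfolding ab using G.component_group_mult[OF c] G.component_group_mult[OF c(2,1)] C.m_comm[OF c]
      by simp_all
    ultimately show ?thesis by blast
  qed
  show "disjoint_family_on (stratum G D \<xi> K) {H. subgroup H G}"
    \<comment> \<open>A common point of two strata gives both inclusions between their indices,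
      hence equality.\<close>
    unfolding disjoint_family_on_def using le by blast
qed

end
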